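(* Let $\hat\theta$ be a parameter vector (in the filter, $\hat\theta=\hat\theta_{t-1}$), and let the matrices $A_k,B_k,H_k^{xx},H_k^{xe},H_k^{xu},H_k^{ux},H_k^{uu},H_k^{ue}$ ($0\le k\le T-1$) and $H_T^{xx},H_T^{xe}$ be as defined in the context, evaluated along the optimal states, controls and costates for the parameter $\hat\theta$. Suppose that $H_k^{uu}$ is invertible for all $0\le k\le T-1$. For $0\le k\le T-1$ define $$\mathcal A_k=A_k-B_k(H_k^{uu})^{-1}H_k^{ux},\quad \mathcal R_k=B_k(H_k^{uu})^{-1}B_k',\quad \mathcal M_k=-B_k(H_k^{uu})^{-1}H_k^{ue},$$ $$\mathcal Q_k=H_k^{xx}-H_k^{xu}(H_k^{uu})^{-1}H_k^{ux},\quad \mathcal N_k=H_k^{xe}-H_k^{xu}(H_k^{uu})^{-1}H_k^{ue}.$$ Then the derivatives $X_k(\hat\theta)=\frac{\partial x_k}{\partial\theta}(\hat\theta)$, $0\le k\le T$, and $U_k(\hat\theta)=\frac{\partial u_k}{\partial\theta}(\hat\theta)$, $0\le k\le T-1$, of the optimal states and controls are obtained via the backward recursions $$\mathcal P_k=\mathcal Q_k+\mathcal A_k'(I+\mathcal P_{k+1}\mathcal R_k)^{-1}\mathcal P_{k+1}\mathcal A_k,$$ $$\mathcal W_k=\mathcal A_k'(I+\mathcal P_{k+1}\mathcal R_k)^{-1}(\mathcal W_{k+1}+\mathcal P_{k+1}\mathcal M_k)+\mathcal N_k$$ for $0\le k\le T-1$ with $\mathcal P_T=H_T^{xx}$ and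 $\mathcal W_T=H_T^{xe}$, together with the forward recursions $$U_k(\hat\theta)=-(H_k^{uu})^{-1}\Big(H_k^{ux}X_k(\hat\theta)+H_k^{ue}+B_k'(I+\mathcal P_{k+1}\mathcal R_k)^{-1}\big(\mathcal P_{k+1}\mathcal A_kX_k(\hat\theta)+\mathcal P_{k+1}\mathcal M_k+\mathcal W_{k+1}\big)\Big),$$ $$X_{k+1}(\hat\theta)=A_kX_k(\hat\theta)+B_kU_k(\hat\theta)$$ for $0\le k\le T-1$ with $X_0(\hat\theta)=0$.
   Context: Let $0<T<\infty$ be an integer horizon, $x_0\in\mathbb R^n$ a given initial state, $f:\mathbb R^n\times\mathbb R^m\to\mathbb R^n$ twice continuously differentiable dynamics, and $c_t(x,u,\theta)$ ($0\le t\le T-1$), $c_T(x,\theta)$ twice continuously differentiable real-valued stage and terminal cost functions depending on a parameter vector $\theta\in\Theta\subset\mathbb R^N$. For each $\theta$, let $x_k(\theta)\in\mathbb R^n$ ($0\le k\le T$) and $u_k(\theta)\in\mathbb R^m$ ($0\le k\le T-1$) denote state and control sequences minimizing $c_T(x_T,\theta)+\sum_{t=0}^{T-1}c_t(x_t,u_t,\theta)$ subject to $x_{t+1}=f(x_t,u_t)$ with the given $x_0$. It is implicit that $\theta\mapsto x_k(\theta)$ and $\theta\mapsto u_k(\theta)$ are defined near $\hat\theta$ and differentiable at $\hat\theta$ (so that the Jacobians $X_k(\hat\theta)\in\mathbb R^{n\times N}$, $U_k(\hat\theta)\in\mathbb R^{m\times N}$ exist), and that the inverses $(I+\mathcal P_{k+1}\mathcal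 R_k)^{-1}$ appearing in the recursions exist. Hamiltonian: $H(t,x_t,u_t,p_{t+1},\theta)=c_t(x_t,u_t,\theta)+f(x_t,u_t)'p_{t+1}$, where $'$ denotes transpose. Costates $p_k(\theta)\in\mathbb R^n$, $1\le k\le T$, are defined by $p_T(\theta)=\frac{\partial c_T}{\partial x_T}(x_T(\theta),\theta)$ and, for $1\le k\le T-1$, $$p_k(\theta)=\frac{\partial c_k}{\partial x_k}(x_k(\theta),u_k(\theta),\theta)+\frac{\partial f'}{\partial x_k}(x_k(\theta),u_k(\theta))\,p_{k+1}(\theta),$$ where gradients are column vectors and $\frac{\partial f'}{\partial x}$ is the transpose of the Jacobian of $f$ in $x$. For $0\le k\le T-1$: $A_k=\frac{\partial f}{\partial x}$ and $B_k=\frac{\partial f}{\partial u}$ evaluated at $(x_k(\hat\theta),u_k(\hat\theta))$; and $$H_k^{xx}=\frac{\partial^2H}{\partial x\,\partial x},\quad H_k^{xe}=\frac{\partial^2H}{\partial x\,\partial\theta},\quad H_k^{xu}=\frac{\partial^2H}{\partial x\,\partial u}=(H_k^{ux})',\quad H_k^{uu}=\frac{\partial^2H}{\partial u\,\partial u},\quad H_k^{ue}=\frac{\partial^2H}{\partial u\,\partial\theta},$$ all evaluated at $(k,x_k(\hat\theta),u_k(\hat\theta),p_{k+1}(\hat\theta),\hat\theta)$, with $p_{k+1}$ treated as an independent variable; the matrix $\frac{\partial^2H}{\partial a\,\partial b}$ has $(i,j)$ entry $\frac{\partial^2H}{\partial a_i\,\partial b_j}$. Finally $H_T^{xx}=\frac{\partial^2c_T}{\partial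 x_T\,\partial x_T}$ and $H_T^{xe}=\frac{\partial^2c_T}{\partial x_T\,\partial\theta}$ evaluated at $(x_T(\hat\theta),\hat\theta)$. *)

theory Defs
  imports "HOL-Analysis.Analysis"
begin

(* Intended for open S: derivatives are taken in the ambient space. *)
definition twice_continuously_differentiable_on ::
    "('a::real_normed_vector \<Rightarrow> 'b::real_normed_vector) \<Rightarrow> 'a set \<Rightarrow> bool" where
  "twice_continuously_differentiable_on g S \<longleftrightarrow>
     (\<exists>(g' :: 'a \<Rightarrow> 'a \<Rightarrow>\<^sub>L 'b) (g'' :: 'a \<Rightarrow> 'a \<Rightarrow>\<^sub>L 'a \<Rightarrow>\<^sub>L 'b).
        (\<forall>z\<in>S. (g has_derivative blinfun_apply (g' z)) (at z)) \<and>
        (\<forall>z\<in>S. (g' has_derivative blinfun_apply (g'' z)) (at z)) \<and>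
        continuous_on S g'')"

definition partial_deriv :: "'n \<Rightarrow> (real^'n \<Rightarrow> real) \<Rightarrow> real^'n \<Rightarrow> real" where
  "partial_deriv i g z = deriv (\<lambda>s. g (z + s *\<^sub>R axis i 1)) 0"

definition gradient :: "(real^'n \<Rightarrow> real) \<Rightarrow> real^'n \<Rightarrow> real^'n" where
  "gradient g z = (\<chi> i. partial_deriv i g z)"

definition hessian :: "(real^'n \<Rightarrow> real) \<Rightarrow> real^'n \<Rightarrow> real^'n^'n" where
  "hessian g z = (\<chi> i j. partial_deriv i (partial_deriv j g) z)"

(* Rows are indexed by the first argument of g, columns by the second. *)
definition mixed_hessian ::
    "(real^'a \<Rightarrow> real^'b \<Rightarrow> real) \<Rightarrow> real^'a \<Rightarrow> real^'b \<Rightarrow> real^'b^'a" where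
  "mixed_hessian g a b = (\<chi> i j. partial_deriv i (\<lambda>a'. partial_deriv j (g a') b) a)"

(* Only the states with index at most T and the controls with index below T matter. *)
definition is_trajectory ::
    "nat \<Rightarrow> real^'n \<Rightarrow> (real^'n \<Rightarrow> real^'m \<Rightarrow> real^'n) \<Rightarrow>
     (nat \<Rightarrow> real^'n) \<Rightarrow> (nat \<Rightarrow> real^'m) \<Rightarrow> bool" where
  "is_trajectory T x0 f xs us \<longleftrightarrow> xs 0 = x0 \<and> (\<forall>t<T. xs (Suc t) = f (xs t) (us t))"

definition total_cost ::
    "nat \<Rightarrow> (nat \<Rightarrow> real^'n \<Rightarrow> real^'m \<Rightarrow> real^'p \<Rightarrow> real) \<Rightarrow> (real^'n \<Rightarrow> real^'p \<Rightarrow> real) \<Rightarrow>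
     real^'p \<Rightarrow> (nat \<Rightarrow> real^'n) \<Rightarrow> (nat \<Rightarrow> real^'m) \<Rightarrow> real" where
  "total_cost T c cT \<theta> xs us = cT (xs T) \<theta> + (\<Sum>t<T. c t (xs t) (us t) \<theta>)"

definition is_optimal ::
    "nat \<Rightarrow> real^'n \<Rightarrow> (real^'n \<Rightarrow> real^'m \<Rightarrow> real^'n) \<Rightarrow>
     (nat \<Rightarrow> real^'n \<Rightarrow> real^'m \<Rightarrow> real^'p \<Rightarrow> real) \<Rightarrow> (real^'n \<Rightarrow> real^'p \<Rightarrow> real) \<Rightarrow>
     real^'p \<Rightarrow> (nat \<Rightarrow> real^'n) \<Rightarrow> (nat \<Rightarrow> real^'m) \<Rightarrow> bool" where
  "is_optimal T x0 f c cT \<theta> xs us \<longleftrightarrow>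
     is_trajectory T x0 f xs us \<and>
     (\<forall>ys vs. is_trajectory T x0 f ys vs \<longrightarrow>
        total_cost T c cT \<theta> xs us \<le> total_cost T c cT \<theta> ys vs)"

definition hamiltonian ::
    "(real^'n \<Rightarrow> real^'m \<Rightarrow> real^'n) \<Rightarrow> (nat \<Rightarrow> real^'n \<Rightarrow> real^'m \<Rightarrow> real^'p \<Rightarrow> real) \<Rightarrow>
     nat \<Rightarrow> real^'n \<Rightarrow> real^'m \<Rightarrow> real^'n \<Rightarrow> real^'p \<Rightarrow> real" where
  "hamiltonian f c t x u q \<theta> = c t x u \<theta> + f x u \<bullet> q"

end

(* Along an optimal trajectory the costate p_k is the gradient of the cost-to-go with the remaining
   controls frozen, so minimality gives H_u = 0 at every stage, for every parameter near \<theta>h.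
   Differentiating p_k = H_x, H_u = 0 and the dynamics at \<theta>h yields, with L_k the Jacobian of p_k,
     L_k = Hxx X_k + Hxu U_k + A' L_{k+1} + Hxe,   0 = Hux X_k + Huu U_k + B' L_{k+1} + Hue.
   Eliminating U_k turns these into the Riccati recursion, and L_k = P_k X_k + W_k follows by
   backward induction. *)
theory Submission
  imports Defs
begin

text \<open>States and controls are assumed differentiable at \<theta>h, but nothing of the kind is
  assumed of the costates. Differentiability of \<open>p k\<close> is therefore proved together with
  the formula for its derivative, going backward in \<open>k\<close>, and stationarity at stage
  \<open>k\<close> can be differentiated only once \<open>p (Suc k)\<close> is known to be
  differentiable. Two mismatches shape the calculus. The Hessians freeze the costate at its value
  for \<theta>h, whereas along the trajectory it moves with \<theta>; since the Hamiltonian is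
  affine in the costate, the difference is the derivative of \<open>f\<close> paired with the change
  of the costate, which is where A' L_{k+1} and B' L_{k+1} come from. Moreover, the Hessians are
  iterated one-dimensional derivatives and have to be identified with blocks of one second Frechet
  derivative. The symmetry of that derivative makes the block for control and state the transpose of
  \<open>Hxu k\<close>, and it makes \<open>Huu k\<close> symmetric, so that transposing
  \<open>\<A> k\<close> gives the matrix that the elimination of the control produces.\<close>

section \<open>Partial derivatives, Hessians and Jacobians as values of Frechet derivatives\<close>

lemma partial_deriv_eq:
  fixes g :: "real^'n \<Rightarrow> real"
  assumes "(g has_derivative D) (at z)"
  shows "partial_deriv i g z = D (axis i 1)"
proof -
  interpret D: bounded_linear D using assms by (rule has_derivative_bounded_linear)
  have "((\<lambda>s. z + s *\<^sub>R axis i 1) has_derivative (\<lambda>s. s *\<^sub>R axis i 1)) (at 0)"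
    by (auto intro!: derivative_eq_intros)
  then have "((\<lambda>s. g (z + s *\<^sub>R axis i 1)) has_derivative (\<lambda>s. D (s *\<^sub>R axis i 1))) (at 0)"
    by (rule has_derivative_compose) (simp add: assms)
  then have "((\<lambda>s. g (z + s *\<^sub>R axis i 1)) has_field_derivative D (axis i 1)) (at 0)"
    by (simp add: has_field_derivative_def D.scaleR mult_commute_abs)
  then show ?thesis
    unfolding partial_deriv_def by (rule DERIV_imp_deriv)
qed

lemma linear_vec_expand:
  fixes F :: "real^'n \<Rightarrow> real"
  assumes "linear F" and "\<And>j. F (axis j 1) = M $ i $ j"
  shows "F h = (M *v h) $ i"
proof -
  have "F h = F (\<Sum>j\<in>UNIV. (h $ j) *\<^sub>R axis j 1)"
    using basis_expansion[of h] by (simp add: scalar_mult_eq_scaleR)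
  also have "\<dots> = (\<Sum>j\<in>UNIV. h $ j * F (axis j 1))"
    by (simp add: linear_sum[OF assms(1)] linear_cmul[OF assms(1)])
  finally show ?thesis
    by (simp add: assms(2) matrix_vector_mult_def mult.commute)
qed

lemma gradient_inner:
  fixes g :: "real^'n \<Rightarrow> real"
  assumes "(g has_derivative D) (at z)"
  shows "D h = gradient g z \<bullet> h"
proof -
  have lin: "linear D" using assms by (rule has_derivative_linear)
  have "D h = D (\<Sum>j\<in>UNIV. (h $ j) *\<^sub>R axis j 1)"
    using basis_expansion[of h] by (simp add: scalar_mult_eq_scaleR)
  also have "\<dots> = (\<Sum>j\<in>UNIV. h $ j * D (axis j 1))"
    by (simp add: linear_sum[OF lin] linear_cmul[OF lin])
  finally show ?thesis
    by (simp add: gradient_def partial_deriv_eq[OF assms] inner_vec_def mult.commute)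
qed

text \<open>The inner partial derivative is itself differentiated in \<open>a'\<close>, so it must
  be known for every \<open>a'\<close>, but only at the single point \<open>b\<close>. In all uses
  \<open>a\<close> is a state or a control, which ranges over the whole space, and the parameter,
  restricted to an open set, takes the place of \<open>b\<close>.\<close>

lemma mixed_hessian_nth:
  assumes "\<And>a'. (g a' has_derivative D a') (at b)"
    and "((\<lambda>a'. D a' (axis j 1)) has_derivative E) (at a)"
  shows "mixed_hessian g a b $ i $ j = E (axis i 1)"
proof -
  have "partial_deriv j (g a') b = D a' (axis j 1)" for a'
    by (rule partial_deriv_eq) (rule assms(1))
  then show ?thesis
    by (simp add: mixed_hessian_def partial_deriv_eq[OF assms(2)])
qed

lemma hessian_nth:
  assumes "\<And>z'. (g has_derivative D z') (at z')"
    and "((\<lambda>z'. D z' (axis j 1)) has_derivative E) (at z)"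
  shows "hessian g z $ i $ j = E (axis i 1)"
proof -
  have "partial_deriv j g = (\<lambda>z'. D z' (axis j 1))"
    by (rule ext, rule partial_deriv_eq) (rule assms(1))
  then show ?thesis
    by (simp add: hessian_def partial_deriv_eq[OF assms(2)])
qed

lemma jacobian_vec:
  fixes f :: "real^'n \<Rightarrow> real^'m"
  assumes "(f has_derivative D) (at z)"
  shows "jacobian f (at z) *v h = D h"
proof -
  have "f differentiable (at z)" using assms by (auto simp: differentiable_def)
  then have "(f has_derivative (*v) (jacobian f (at z))) (at z)"
    by (simp only: jacobian_works)
  from has_derivative_unique[OF this assms] show ?thesis by (rule fun_cong)
qed

section \<open>Symmetry of the second derivative\<close>

text \<open>The mean value theorem in direction \<open>a\<close> turns the second difference into
  \<open>t\<close> times the difference of \<open>g' _ a\<close> at two points that are exactly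
  \<open>t *\<^sub>R b\<close> apart. Differentiability of \<open>g' _ a\<close> at \<open>z\<close>
  expands both values about \<open>z\<close>, and the linear parts differ by
  \<open>t * G b\<close>.\<close>

lemma second_difference_bound:
  fixes g :: "'a::real_normed_vector \<Rightarrow> real"
  assumes S: "open S" "z \<in> S"
    and g: "\<And>w. w \<in> S \<Longrightarrow> (g has_derivative g' w) (at w)"
    and g': "((\<lambda>w. g' w a) has_derivative G) (at z)"
    and "0 < e"
  shows "\<forall>\<^sub>F t in at_right 0.
    \<bar>g (z + t *\<^sub>R a + t *\<^sub>R b) - g (z + t *\<^sub>R a) - g (z + t *\<^sub>R b) + g z - t\<^sup>2 * G b\<bar> \<le> e * t\<^sup>2"
proof -
  interpret G: bounded_linear G using g' by (rule has_derivative_bounded_linear)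
  \<comment> \<open>Both points lie within \<open>t * (norm a + norm b)\<close> of \<open>z\<close>
    and each contributes one error term; \<open>K\<close> dominates the sum of the two. The summand
    1 keeps \<open>K\<close> positive when \<open>a\<close> and \<open>b\<close> vanish.\<close>
  define K where "K = 2 * norm a + 2 * norm b + 1"
  have K: "0 < K" by (simp add: K_def add_nonneg_pos)
  have "0 < e / K" using \<open>0 < e\<close> K by simp
  then obtain d where d: "0 < d" "\<And>w. norm (w - z) < d \<Longrightarrow>
      \<bar>g' w a - g' z a - G (w - z)\<bar> \<le> e / K * norm (w - z)"
    using g' unfolding has_derivative_at_alt real_norm_def by blast
  obtain r where r: "0 < r" "ball z r \<subseteq> S"
    using S open_contains_ball by blast
  have "\<forall>\<^sub>F t in at_right 0. 0 < t \<and> t * K < min d r"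
  proof -
    have "((\<lambda>t. t * K) \<longlongrightarrow> 0 * K) (at_right 0)" by (intro tendsto_intros)
    then have "\<forall>\<^sub>F t in at_right 0. t * K < min d r"
      using d(1) r(1) by (intro order_tendstoD(2)[where y = "0 * K"]) auto
    then show ?thesis
      using eventually_at_right_less[of "0::real"] by eventually_elim auto
  qed
  then show ?thesis
  proof eventually_elim
    case (elim t)
    then have t: "0 < t" "t * K < d" "t * K < r" by auto
    \<comment> \<open>\<open>P\<close> and \<open>Q\<close> run along the two sides of the
      parallelogram parallel to \<open>a\<close>, so the increment of
      \<open>psi = g o P - g o Q\<close> over [0, 1] is the second difference.\<close>
    define P where "P s = z + (s * t) *\<^sub>R a + t *\<^sub>R b" for s
    define Q where "Q s = z + (s * t) *\<^sub>R a" for s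
    have nP: "norm (P s - z) \<le> t * (norm a + norm b)"
      and nQ: "norm (Q s - z) \<le> t * (norm a + norm b)" if "0 \<le> s" "s \<le> 1" for s
    proof -
      have st: "s * t * norm a \<le> t * norm a"
        using that t(1) by (simp add: mult_left_le_one_le mult_right_mono)
      have "norm (P s - z) \<le> norm ((s * t) *\<^sub>R a) + norm (t *\<^sub>R b)"
        unfolding P_def using norm_triangle_ineq[of "(s * t) *\<^sub>R a" "t *\<^sub>R b"]
        by (simp add: algebra_simps)
      also have "\<dots> = s * t * norm a + t * norm b" using that t(1) by (simp add: abs_mult)
      finally show "norm (P s - z) \<le> t * (norm a + norm b)" using st by (simp add: algebra_simps)
      have "norm (Q s - z) = s * t * norm a"
        using that t(1) by (simp add: Q_def abs_mult)
      then show "norm (Q s - z) \<le> t * (norm a + norm b)"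
        using st t(1) by (simp only: distrib_left) (simp add: add_increasing2)
    qed
    have small: "t * (norm a + norm b) < t * K"
      using t(1) by (simp add: K_def add_pos_nonneg add_nonneg_pos add_strict_increasing2)
    have PS: "P s \<in> S" and QS: "Q s \<in> S" if "0 \<le> s" "s \<le> 1" for s
    proof -
      have "dist z (P s) < r" "dist z (Q s) < r"
        using nP[OF that] nQ[OF that] small t(3) by (auto simp: dist_norm norm_minus_commute)
      then show "P s \<in> S" "Q s \<in> S" using r(2) by auto
    qed
    define psi where "psi s = g (P s) - g (Q s)" for s
    have "\<exists>s>0. s < 1 \<and> psi 1 - psi 0 = (1 - 0) * (t * (g' (P s) a - g' (Q s) a))"
    proof (rule MVT2)
      fix s :: real assume s: "0 \<le> s" "s \<le> 1"
      interpret gP: bounded_linear "g' (P s)"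
        using g[OF PS[OF s]] by (rule has_derivative_bounded_linear)
      interpret gQ: bounded_linear "g' (Q s)"
        using g[OF QS[OF s]] by (rule has_derivative_bounded_linear)
      have dP: "(P has_derivative (\<lambda>h. (h * t) *\<^sub>R a)) (at s)"
        and dQ: "(Q has_derivative (\<lambda>h. (h * t) *\<^sub>R a)) (at s)"
        by (auto simp: P_def[abs_def] Q_def[abs_def] intro!: derivative_eq_intros)
      have "((\<lambda>s. g (P s)) has_derivative (\<lambda>h. g' (P s) ((h * t) *\<^sub>R a))) (at s)"
        by (rule has_derivative_compose[OF dP g[OF PS[OF s]]])
      moreover have "((\<lambda>s. g (Q s)) has_derivative (\<lambda>h. g' (Q s) ((h * t) *\<^sub>R a))) (at s)"
        by (rule has_derivative_compose[OF dQ g[OF QS[OF s]]])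
      ultimately have "(psi has_derivative
          (\<lambda>h. g' (P s) ((h * t) *\<^sub>R a) - g' (Q s) ((h * t) *\<^sub>R a))) (at s)"
        unfolding psi_def[abs_def] by (rule has_derivative_diff)
      also have "(\<lambda>h. g' (P s) ((h * t) *\<^sub>R a) - g' (Q s) ((h * t) *\<^sub>R a))
          = (*) (t * (g' (P s) a - g' (Q s) a))"
        by (rule ext) (simp add: gP.scaleR gQ.scaleR algebra_simps)
      finally show "(psi has_real_derivative t * (g' (P s) a - g' (Q s) a)) (at s)"
        by (simp add: has_field_derivative_def)
    qed simp
    then obtain s where s: "0 < s" "s < 1"
      and mvt: "psi 1 - psi 0 = t * (g' (P s) a - g' (Q s) a)" by auto
    have le: "\<bar>g' w a - g' z a - G (w - z)\<bar> \<le> e / K * (t * (norm a + norm b))"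
      if "norm (w - z) \<le> t * (norm a + norm b)" for w
    proof -
      have "\<bar>g' w a - g' z a - G (w - z)\<bar> \<le> e / K * norm (w - z)"
        using that small t(2) by (intro d(2)) linarith
      also have "\<dots> \<le> e / K * (t * (norm a + norm b))"
        using that \<open>0 < e\<close> K by (intro mult_left_mono) auto
      finally show ?thesis .
    qed
    \<comment> \<open>The mean value point \<open>s\<close> is unknown, but it cancels: by linearity
      \<open>G (P s - z)\<close> and \<open>G (Q s - z)\<close> differ by \<open>t * G b\<close> for
      every \<open>s\<close>.\<close>
    have "P s - z = (Q s - z) + t *\<^sub>R b" by (simp add: P_def Q_def)
    then have GPQ: "G (P s - z) = G (Q s - z) + t * G b"
      by (simp only: G.add G.scaleR real_scaleR_def)
    have "\<bar>g' (P s) a - g' (Q s) a - t * G b\<bar> \<le> 2 * (e / K * (t * (norm a + norm b)))"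
      using le[OF nP, of s] le[OF nQ, of s] s GPQ by linarith
    also have "\<dots> = e * t * ((2 * norm a + 2 * norm b) / K)"
      by (simp add: field_simps)
    also have "\<dots> \<le> e * t"
      using \<open>0 < e\<close> t(1) K by (intro mult_left_le) (auto simp: K_def)
    finally have main: "\<bar>g' (P s) a - g' (Q s) a - t * G b\<bar> \<le> e * t" .
    have "g (z + t *\<^sub>R a + t *\<^sub>R b) - g (z + t *\<^sub>R a) - g (z + t *\<^sub>R b) + g z - t\<^sup>2 * G b
        = t * (g' (P s) a - g' (Q s) a - t * G b)"
      using mvt by (simp add: psi_def P_def Q_def power2_eq_square algebra_simps)
    then show ?case
      using mult_left_mono[OF main, of t] t(1)
      by (simp add: abs_mult power2_eq_square mult_ac)
  qed
qed

text \<open>The second difference in \<open>second_difference_bound\<close> is symmetric in \<open>a\<close> and \<open>b\<close>, so its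
  two limits after division by \<open>t\<^sup>2\<close> agree.\<close>
lemma second_derivative_symmetric:
  fixes g :: "'a::real_normed_vector \<Rightarrow> real"
  assumes S: "open S" "z \<in> S"
    and g: "\<And>w. w \<in> S \<Longrightarrow> (g has_derivative g' w) (at w)"
    and g': "\<And>e. ((\<lambda>w. g' w e) has_derivative (\<lambda>d. E d e)) (at z)"
  shows "E a b = E b a"
proof (rule ccontr)
  assume ne: "E a b \<noteq> E b a"
  \<comment> \<open>The two estimates of the same second difference put the values within
    \<open>2 * e\<close> of each other, while their distance is \<open>3 * e\<close>.\<close>
  define e where "e = \<bar>E a b - E b a\<bar> / 3"
  have e: "0 < e" using ne by (simp add: e_def)
  have diff: "\<forall>\<^sub>F t in at_right 0. \<bar>g (z + t *\<^sub>R a' + t *\<^sub>R b') - g (z + t *\<^sub>R a') - g (z + t *\<^sub>R b') + g z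
      - t\<^sup>2 * E b' a'\<bar> \<le> e * t\<^sup>2" for a' b'
    by (rule second_difference_bound[OF S _ g' e]) (rule g)
  have "\<forall>\<^sub>F t::real in at_right 0. False"
    using diff[of a b] diff[of b a] eventually_at_right_less[of "0::real"]
  proof eventually_elim
    case (elim t)
    have "z + t *\<^sub>R b + t *\<^sub>R a = z + t *\<^sub>R a + t *\<^sub>R b" by simp
    then have "\<bar>t\<^sup>2 * E a b - t\<^sup>2 * E b a\<bar> \<le> 2 * (e * t\<^sup>2)"
      using elim by (simp only:)
    also have "\<bar>t\<^sup>2 * E a b - t\<^sup>2 * E b a\<bar> = t\<^sup>2 * \<bar>E a b - E b a\<bar>"
      by (simp add: abs_mult flip: right_diff_distrib)
    finally have "t\<^sup>2 * \<bar>E a b - E b a\<bar> \<le> t\<^sup>2 * (2 * e)"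
      by (simp only: mult_ac)
    then have "\<bar>E a b - E b a\<bar> \<le> 2 * e" using elim by simp
    then show ?case using e by (simp add: e_def)
  qed
  then show False by simp
qed

section \<open>Cost-to-go, costates and stationarity of the Hamiltonian\<close>

text \<open>This is not the Bellman value function: the controls stay at \<open>us\<close> whatever
  the state \<open>y\<close>, so it is a composition of smooth maps and the chain rule applies to
  it. The recursion is on the number \<open>j\<close> of remaining stages; \<open>k\<close> is the
  absolute time that selects cost and control, and \<open>k + j\<close> is the horizon
  throughout.\<close>

primrec cost_to_go :: "('x \<Rightarrow> 'u \<Rightarrow> 'x) \<Rightarrow> (nat \<Rightarrow> 'x \<Rightarrow> 'u \<Rightarrow> real) \<Rightarrow> ('x \<Rightarrow> real) \<Rightarrow>
    (nat \<Rightarrow> 'u) \<Rightarrow> nat \<Rightarrow> nat \<Rightarrow> 'x \<Rightarrow> real" where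
  "cost_to_go f c cT us 0 k y = cT y"
| "cost_to_go f c cT us (Suc j) k y = c k y (us k) + cost_to_go f c cT us j (Suc k) (f y (us k))"

lemma cost_to_go_trajectory:
  assumes "\<And>t. k \<le> t \<Longrightarrow> t < k + j \<Longrightarrow> xs (Suc t) = f (xs t) (us t)"
  shows "cost_to_go f c cT us j k (xs k) = cT (xs (k + j)) + (\<Sum>t=k..<k+j. c t (xs t) (us t))"
  using assms
proof (induction j arbitrary: k)
  case (Suc j)
  have "cost_to_go f c cT us (Suc j) k (xs k)
      = c k (xs k) (us k) + cost_to_go f c cT us j (Suc k) (xs (Suc k))"
    using Suc.prems[of k] by simp
  also have "\<dots> = c k (xs k) (us k) + (cT (xs (k + Suc j)) + (\<Sum>t=Suc k..<k + Suc j. c t (xs t) (us t)))"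
    using Suc.IH[of "Suc k"] Suc.prems by simp
  finally show ?case by (simp add: sum.atLeast_Suc_lessThan)
qed simp

text \<open>Only the control at stage \<open>k\<close> is replaced by \<open>v\<close>, and the
  states are regenerated from \<open>x0\<close>. Up to time \<open>k\<close> they are unchanged, so
  the earlier costs cancel. From \<open>Suc k\<close> on the old controls act on the new state,
  which is what the cost-to-go measures.\<close>

lemma optimal_control_minimizes:
  assumes opt: "is_optimal T x0 f c cT \<theta> xs us" and k: "k < T"
  shows "c k (xs k) (us k) \<theta> + cost_to_go f (\<lambda>t y v. c t y v \<theta>) (\<lambda>y. cT y \<theta>) us (T - Suc k) (Suc k) (f (xs k) (us k))
     \<le> c k (xs k) v \<theta> + cost_to_go f (\<lambda>t y v. c t y v \<theta>) (\<lambda>y. cT y \<theta>) us (T - Suc k) (Suc k) (f (xs k) v)"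
proof -
  define vs where "vs = us(k := v)"
  define ys where "ys = rec_nat x0 (\<lambda>t y. f y (vs t))"
  have ys_Suc: "ys (Suc t) = f (ys t) (vs t)" for t by (simp add: ys_def)
  have traj: "is_trajectory T x0 f xs us" using opt by (simp add: is_optimal_def)
  have ys_le: "ys t = xs t" if "t \<le> k" for t
    using that
  proof (induction t)
    case 0 then show ?case using traj by (simp add: ys_def is_trajectory_def)
  next
    case (Suc t) then show ?case using traj k by (simp add: ys_Suc is_trajectory_def vs_def)
  qed
  have "is_trajectory T x0 f ys vs" by (simp add: is_trajectory_def ys_Suc) (simp add: ys_def)
  then have le: "total_cost T c cT \<theta> xs us \<le> total_cost T c cT \<theta> ys vs"
    using opt by (simp add: is_optimal_def)
  have split: "(\<Sum>t<T. h t) = (\<Sum>t<k. h t) + (h k + (\<Sum>t=Suc k..<T. h t))" for h :: "nat \<Rightarrow> real"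
    using k sum.atLeastLessThan_concat[of 0 k T h] sum.atLeast_Suc_lessThan[of k T h]
    by (simp only: lessThan_atLeast0)
  let ?V = "cost_to_go f (\<lambda>t y v. c t y v \<theta>) (\<lambda>y. cT y \<theta>) us (T - Suc k) (Suc k)"
  have Vx: "?V (xs (Suc k)) = cT (xs T) \<theta> + (\<Sum>t=Suc k..<T. c t (xs t) (us t) \<theta>)"
    using cost_to_go_trajectory[of "Suc k" "T - Suc k" xs f us] traj k
    by (simp add: is_trajectory_def)
  have "?V (ys (Suc k)) = cT (ys T) \<theta> + (\<Sum>t=Suc k..<T. c t (ys t) (us t) \<theta>)"
    using cost_to_go_trajectory[of "Suc k" "T - Suc k" ys f us] k
    by (simp add: ys_Suc vs_def)
  also have "\<dots> = cT (ys T) \<theta> + (\<Sum>t=Suc k..<T. c t (ys t) (vs t) \<theta>)"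
    by (simp add: vs_def)
  finally have Vy: "?V (ys (Suc k)) = \<dots>" .
  have xk: "xs (Suc k) = f (xs k) (us k)" using traj k by (simp add: is_trajectory_def)
  have yk: "ys (Suc k) = f (xs k) v" using ys_le[of k] by (simp add: ys_Suc vs_def)
  have "(\<Sum>t<k. c t (ys t) (vs t) \<theta>) = (\<Sum>t<k. c t (xs t) (us t) \<theta>)"
    by (rule sum.cong) (auto simp: ys_le vs_def)
  then show ?thesis
    using le Vx Vy ys_le[of k] unfolding total_cost_def split xk yk by (simp add: vs_def)
qed

lemma inner_matrix_vector_transpose:
  fixes M :: "real^'n^'m"
  shows "q \<bullet> (M *v h) = (transpose M *v q) \<bullet> h"
  by (simp add: transpose_matrix_vector dot_lmul_matrix)

text \<open>Differentiating the recursion of \<open>cost_to_go\<close> by the chain rule, with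
  gradients as column vectors, reproduces the costate recursion term by term. The restriction to
  \<open>1 \<le> k\<close> is the range on which costates are defined.\<close>

lemma costate_is_cost_to_go_gradient:
  fixes f :: "real^'n \<Rightarrow> 'u \<Rightarrow> real^'n"
  assumes f: "\<And>y v. (\<lambda>y. f y v) differentiable (at y)"
    and c: "\<And>t y v. t < T \<Longrightarrow> (\<lambda>y. c t y v) differentiable (at y)"
    and cT: "\<And>y. cT differentiable (at y)"
    and traj: "\<And>t. t < T \<Longrightarrow> xs (Suc t) = f (xs t) (us t)"
    and p_T: "p T = gradient cT (xs T)"
    and p: "\<And>k. 1 \<le> k \<Longrightarrow> k < T \<Longrightarrow> p k = gradient (\<lambda>y. c k y (us k)) (xs k)
      + transpose (jacobian (\<lambda>y. f y (us k)) (at (xs k))) *v p (Suc k)"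
    and "1 \<le> k" "k + j = T"
  shows "(cost_to_go f c cT us j k has_derivative (\<lambda>h. p k \<bullet> h)) (at (xs k))"
  using \<open>1 \<le> k\<close> \<open>k + j = T\<close>
proof (induction j arbitrary: k)
  case 0
  have "(cT has_derivative frechet_derivative cT (at (xs T))) (at (xs T))"
    using cT frechet_derivative_works by blast
  moreover have "frechet_derivative cT (at (xs T)) = (\<lambda>h. p T \<bullet> h)"
    unfolding p_T by (rule ext, rule gradient_inner) fact
  ultimately show ?case using 0 by simp
next
  case (Suc j)
  then have k: "k < T" by simp
  let ?J = "jacobian (\<lambda>y. f y (us k)) (at (xs k))"
  obtain D where D: "((\<lambda>y. c k y (us k)) has_derivative D) (at (xs k))"
    using c[OF k] by (meson differentiable_def)
  have J: "((\<lambda>y. f y (us k)) has_derivative (*v) ?J) (at (xs k))"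
    using f jacobian_works by blast
  have IH: "(cost_to_go f c cT us j (Suc k) has_derivative (\<lambda>h. p (Suc k) \<bullet> h)) (at (f (xs k) (us k)))"
    using Suc.IH[of "Suc k"] Suc.prems traj[OF k] by simp
  have "(cost_to_go f c cT us (Suc j) k has_derivative (\<lambda>h. D h + p (Suc k) \<bullet> (?J *v h))) (at (xs k))"
    unfolding cost_to_go.simps[abs_def]
    by (rule has_derivative_add[OF D has_derivative_compose[OF J IH]])
  also have "(\<lambda>h. D h + p (Suc k) \<bullet> (?J *v h)) = (\<lambda>h. p k \<bullet> h)"
    unfolding gradient_inner[OF D] inner_matrix_vector_transpose p[OF Suc.prems(1) k]
    by (simp only: inner_add_left)
  finally show ?case .
qed

text \<open>This reads the costate recursion as p_k = H_x with the next costate held fixed, the form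
  in which it can be differentiated in the parameter.\<close>

lemma hamiltonian_state_gradient:
  fixes f :: "real^'n \<Rightarrow> real^'m \<Rightarrow> real^'n"
  assumes "(\<lambda>y. f y v) differentiable (at y)" and "(\<lambda>y. c k y v \<theta>) differentiable (at y)"
  shows "((\<lambda>y. hamiltonian f c k y v q \<theta>) has_derivative
    (\<lambda>h. (gradient (\<lambda>y. c k y v \<theta>) y + transpose (jacobian (\<lambda>y. f y v) (at y)) *v q) \<bullet> h)) (at y)"
proof -
  obtain D where D: "((\<lambda>y. c k y v \<theta>) has_derivative D) (at y)"
    using assms(2) by (meson differentiable_def)
  have J: "((\<lambda>y. f y v) has_derivative (*v) (jacobian (\<lambda>y. f y v) (at y))) (at y)"
    using assms(1) jacobian_works by blast
  have "(\<lambda>h. (gradient (\<lambda>y. c k y v \<theta>) y + transpose (jacobian (\<lambda>y. f y v) (at y)) *v q) \<bullet> h)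
      = (\<lambda>h. D h + (jacobian (\<lambda>y. f y v) (at y) *v h) \<bullet> q)"
    unfolding inner_commute[of _ q] gradient_inner[OF D] inner_matrix_vector_transpose
    by (simp only: inner_add_left)
  with has_derivative_add[OF D has_derivative_inner_left[OF J, of q]] show ?thesis
    by (simp only: hamiltonian_def)
qed

text \<open>By the chain rule, stage cost plus cost-to-go has in \<open>v\<close> the same
  derivative at \<open>us k\<close> as the Hamiltonian with the costate frozen at
  \<open>p (Suc k)\<close>. The former is minimal there, so its derivative vanishes.\<close>

lemma optimal_control_stationary:
  fixes f :: "real^'n \<Rightarrow> real^'m \<Rightarrow> real^'n"
  assumes opt: "is_optimal T x0 f c cT \<theta> xs us" and k: "k < T"
    and fy: "\<And>y v. (\<lambda>y. f y v) differentiable (at y)"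
    and fv: "\<And>y v. (\<lambda>v. f y v) differentiable (at v)"
    and cy: "\<And>t y v. t < T \<Longrightarrow> (\<lambda>y. c t y v \<theta>) differentiable (at y)"
    and cv: "\<And>t y v. t < T \<Longrightarrow> (\<lambda>v. c t y v \<theta>) differentiable (at v)"
    and cT: "\<And>y. (\<lambda>y. cT y \<theta>) differentiable (at y)"
    and p_T: "p T = gradient (\<lambda>y. cT y \<theta>) (xs T)"
    and p: "\<And>k. 1 \<le> k \<Longrightarrow> k < T \<Longrightarrow> p k = gradient (\<lambda>y. c k y (us k) \<theta>) (xs k)
      + transpose (jacobian (\<lambda>y. f y (us k)) (at (xs k))) *v p (Suc k)"
  shows "((\<lambda>v. hamiltonian f c k (xs k) v (p (Suc k)) \<theta>) has_derivative (\<lambda>h. 0)) (at (us k))"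
proof -
  let ?V = "cost_to_go f (\<lambda>t y v. c t y v \<theta>) (\<lambda>y. cT y \<theta>) us (T - Suc k) (Suc k)"
  have traj: "\<And>t. t < T \<Longrightarrow> xs (Suc t) = f (xs t) (us t)"
    using opt by (simp add: is_optimal_def is_trajectory_def)
  have "(?V has_derivative (\<lambda>h. p (Suc k) \<bullet> h)) (at (xs (Suc k)))"
    by (rule costate_is_cost_to_go_gradient[where T = T])
      (use fy cy cT traj p_T p k in auto)
  then have V: "(?V has_derivative (\<lambda>h. p (Suc k) \<bullet> h)) (at (f (xs k) (us k)))"
    by (simp add: traj k)
  obtain D where D: "((\<lambda>v. c k (xs k) v \<theta>) has_derivative D) (at (us k))"
    using cv[OF k] by (meson differentiable_def)
  obtain J where J: "((\<lambda>v. f (xs k) v) has_derivative J) (at (us k))"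
    using fv by (meson differentiable_def)
  have "((\<lambda>v. c k (xs k) v \<theta> + ?V (f (xs k) v)) has_derivative (\<lambda>h. D h + p (Suc k) \<bullet> J h)) (at (us k))"
    by (rule has_derivative_add[OF D has_derivative_compose[OF J V]])
  then have "(\<lambda>h. D h + p (Suc k) \<bullet> J h) = (\<lambda>h. 0)"
    by (rule has_derivative_local_min)
      (use optimal_control_minimizes[OF opt k] in \<open>auto intro!: always_eventually\<close>)
  moreover have "((\<lambda>v. hamiltonian f c k (xs k) v (p (Suc k)) \<theta>) has_derivative
      (\<lambda>h. D h + J h \<bullet> p (Suc k))) (at (us k))"
    unfolding hamiltonian_def by (intro has_derivative_add D has_derivative_inner_left J)
  ultimately show ?thesis by (simp add: inner_commute)
qed

section \<open>Differentiating the gradients of the Hamiltonian along parametrized curves\<close>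

text \<open>One joint derivative \<open>D q\<close> in state, control and parameter, and its
  derivative \<open>E q\<close>, serve all Hessian blocks. The last property says that
  \<open>D q\<close> is affine in \<open>q\<close> with slope given by the derivative
  \<open>F\<close> of \<open>f\<close>; it lets the costate vary by a product rule although the
  Hessians keep it fixed.\<close>

lemma hamiltonian_second_order:
  fixes f :: "real^'n \<Rightarrow> real^'m \<Rightarrow> real^'n"
    and c :: "nat \<Rightarrow> real^'n \<Rightarrow> real^'m \<Rightarrow> real^'p \<Rightarrow> real"
  assumes f: "twice_continuously_differentiable_on (\<lambda>(y, v). f y v) UNIV"
    and c: "twice_continuously_differentiable_on (\<lambda>(y, v, \<theta>). c k y v \<theta>) (UNIV \<times> UNIV \<times> S)"
  obtains D E F where
    "\<And>q y v \<theta>. \<theta> \<in> S \<Longrightarrow>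
      ((\<lambda>(y, v, \<theta>). hamiltonian f c k y v q \<theta>) has_derivative D q (y, v, \<theta>)) (at (y, v, \<theta>))"
    "\<And>q e y v \<theta>. \<theta> \<in> S \<Longrightarrow>
      ((\<lambda>z. D q z e) has_derivative (\<lambda>d. E q (y, v, \<theta>) d e)) (at (y, v, \<theta>))"
    "\<And>w. ((\<lambda>(y, v). f y v) has_derivative F w) (at w)"
    "\<And>e w. (\<lambda>w. F w e) differentiable (at w)"
    "\<And>q q' y v \<theta> a b d. D q (y, v, \<theta>) (a, b, d) = D q' (y, v, \<theta>) (a, b, d) + F (y, v) (a, b) \<bullet> (q - q')"
proof -
  obtain f' f'' where f': "\<And>w. ((\<lambda>(y, v). f y v) has_derivative blinfun_apply (f' w)) (at w)"
    and f'': "\<And>w. (f' has_derivative blinfun_apply (f'' w)) (at w)"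
    using f unfolding twice_continuously_differentiable_on_def by auto
  obtain c' c'' where
      "\<forall>z\<in>UNIV \<times> UNIV \<times> S. ((\<lambda>(y, v, \<theta>). c k y v \<theta>) has_derivative blinfun_apply (c' z)) (at z)"
      "\<forall>z\<in>UNIV \<times> UNIV \<times> S. (c' has_derivative blinfun_apply (c'' z)) (at z)"
    using c unfolding twice_continuously_differentiable_on_def by blast
  then have c': "\<And>y v \<theta>. \<theta> \<in> S \<Longrightarrow>
      ((\<lambda>(y, v, \<theta>). c k y v \<theta>) has_derivative blinfun_apply (c' (y, v, \<theta>))) (at (y, v, \<theta>))"
    and c'': "\<And>y v \<theta>. \<theta> \<in> S \<Longrightarrow> (c' has_derivative blinfun_apply (c'' (y, v, \<theta>))) (at (y, v, \<theta>))"
    by auto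
  \<comment> \<open>\<open>f\<close> does not see the parameter, so its derivatives are pulled back
    along the projection that forgets \<theta>. The projection is linear, hence its own
    derivative.\<close>
  define pr :: "(real^'n) \<times> (real^'m) \<times> (real^'p) \<Rightarrow> (real^'n) \<times> (real^'m)"
    where "pr z = (fst z, fst (snd z))" for z
  have pr: "(pr has_derivative pr) (at z)" for z
    unfolding pr_def[abs_def] by (auto intro!: derivative_eq_intros)
  define D where "D q z e = c' z e + f' (pr z) (pr e) \<bullet> q" for q z e
  define E where "E q z d e = c'' z d e + f'' (pr z) (pr d) (pr e) \<bullet> q" for q z d e
  show thesis
  proof (rule that[of D E "\<lambda>w. blinfun_apply (f' w)"])
    fix q y v and \<theta> :: "real^'p" assume th: "\<theta> \<in> S"
    have "((\<lambda>z. (case pr z of (y, v) \<Rightarrow> f y v)) has_derivative (\<lambda>e. f' (pr (y, v, \<theta>)) (pr e))) (at (y, v, \<theta>))"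
      by (rule has_derivative_compose[OF pr f'])
    from has_derivative_add[OF c'[OF th] has_derivative_inner_left[OF this, of q]]
    show "((\<lambda>(y, v, \<theta>). hamiltonian f c k y v q \<theta>) has_derivative D q (y, v, \<theta>)) (at (y, v, \<theta>))"
      by (simp add: D_def[abs_def] hamiltonian_def pr_def case_prod_beta')
    fix e
    have "((\<lambda>z. c' z e) has_derivative (\<lambda>d. c'' (y, v, \<theta>) d e)) (at (y, v, \<theta>))"
      by (rule bounded_linear.has_derivative[OF blinfun.bounded_linear_left c''[OF th]])
    moreover have "((\<lambda>z. f' (pr z) (pr e)) has_derivative (\<lambda>d. f'' (pr (y, v, \<theta>)) (pr d) (pr e))) (at (y, v, \<theta>))"
      by (rule bounded_linear.has_derivative[OF blinfun.bounded_linear_left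
            has_derivative_compose[OF pr f'']])
    ultimately show "((\<lambda>z. D q z e) has_derivative (\<lambda>d. E q (y, v, \<theta>) d e)) (at (y, v, \<theta>))"
      unfolding D_def E_def by (intro has_derivative_add has_derivative_inner_left)
  next
    fix e w show "(\<lambda>w. blinfun_apply (f' w) e) differentiable (at w)"
      using bounded_linear.has_derivative[OF blinfun.bounded_linear_left f'']
      by (meson differentiable_def)
  next
    fix q q' y v a b and \<theta> d :: "real^'p"
    show "D q (y, v, \<theta>) (a, b, d) = D q' (y, v, \<theta>) (a, b, d) + blinfun_apply (f' (y, v)) (a, b) \<bullet> (q - q')"
      by (simp add: D_def pr_def inner_diff_right)
  qed (rule f')
qed

lemma has_derivative_vecI:
  fixes r :: "'a::real_normed_vector \<Rightarrow> real^'n"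
  assumes "\<And>i. ((\<lambda>w. r w $ i) has_derivative (\<lambda>d. R d $ i)) (at z)"
  shows "(r has_derivative R) (at z)"
  unfolding has_derivative_componentwise_within[of r R z UNIV]
  using assms by (auto simp: Basis_vec_def inner_axis)

lemma has_derivative_transform_nhds:
  assumes f: "(f has_derivative f') (at z)" and ev: "\<forall>\<^sub>F w in nhds z. f w = g w"
  shows "(g has_derivative f') (at z)"
proof (rule has_derivative_transform_eventually[OF f])
  show "\<forall>\<^sub>F w in at z. f w = g w"
    using ev by (simp add: eventually_nhds_conv_at)
  show "f z = g z"
    using ev by (rule eventually_nhds_x_imp_x)
qed simp

text \<open>Each component of the gradient along the curve is \<open>D (q \<theta>)\<close> at the
  curve point, applied to a coordinate vector; the chain rule through \<open>E0\<close> and the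
  affine dependence on \<open>q\<close> give its derivative. \<open>r\<close> and \<open>s\<close>
  are any functions that equal the gradients near \<theta>h: later \<open>r\<close> is a costate and
  \<open>s\<close> is constantly 0.\<close>

lemma hamiltonian_gradient_derivative:
  fixes f :: "real^'n \<Rightarrow> real^'m \<Rightarrow> real^'n"
    and c :: "nat \<Rightarrow> real^'n \<Rightarrow> real^'m \<Rightarrow> real^'p \<Rightarrow> real"
    and \<xi> q :: "real^'p \<Rightarrow> real^'n" and \<upsilon> :: "real^'p \<Rightarrow> real^'m"
  assumes f: "twice_continuously_differentiable_on (\<lambda>(y, v). f y v) UNIV"
    and c: "twice_continuously_differentiable_on (\<lambda>(y, v, \<theta>). c k y v \<theta>) (UNIV \<times> UNIV \<times> S)"
    and S: "open S" "\<theta>h \<in> S"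
    and \<xi>: "(\<xi> has_derivative X) (at \<theta>h)"
    and \<upsilon>: "(\<upsilon> has_derivative U) (at \<theta>h)"
    and q: "(q has_derivative L) (at \<theta>h)"
  defines "h \<equiv> \<lambda>y v \<theta>. hamiltonian f c k y v (q \<theta>h) \<theta>"
  shows hamiltonian_state_gradient_derivative:
    "\<forall>\<^sub>F \<theta> in nhds \<theta>h. ((\<lambda>y. hamiltonian f c k y (\<upsilon> \<theta>) (q \<theta>) \<theta>) has_derivative (\<lambda>e. r \<theta> \<bullet> e)) (at (\<xi> \<theta>))
      \<Longrightarrow> (r has_derivative (\<lambda>d. hessian (\<lambda>y. h y (\<upsilon> \<theta>h) \<theta>h) (\<xi> \<theta>h) *v X d
          + mixed_hessian (\<lambda>y v. h y v \<theta>h) (\<xi> \<theta>h) (\<upsilon> \<theta>h) *v U d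
          + transpose (jacobian (\<lambda>y. f y (\<upsilon> \<theta>h)) (at (\<xi> \<theta>h))) *v L d
          + mixed_hessian (\<lambda>y \<theta>. h y (\<upsilon> \<theta>h) \<theta>) (\<xi> \<theta>h) \<theta>h *v d)) (at \<theta>h)"
      (is "?P \<Longrightarrow> ?P'")
    and hamiltonian_control_gradient_derivative:
    "\<forall>\<^sub>F \<theta> in nhds \<theta>h. ((\<lambda>v. hamiltonian f c k (\<xi> \<theta>) v (q \<theta>) \<theta>) has_derivative (\<lambda>e. s \<theta> \<bullet> e)) (at (\<upsilon> \<theta>))
      \<Longrightarrow> (s has_derivative (\<lambda>d. transpose (mixed_hessian (\<lambda>y v. h y v \<theta>h) (\<xi> \<theta>h) (\<upsilon> \<theta>h)) *v X d
          + hessian (\<lambda>v. h (\<xi> \<theta>h) v \<theta>h) (\<upsilon> \<theta>h) *v U d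
          + transpose (jacobian (\<lambda>v. f (\<xi> \<theta>h) v) (at (\<upsilon> \<theta>h))) *v L d
          + mixed_hessian (\<lambda>v \<theta>. h (\<xi> \<theta>h) v \<theta>) (\<upsilon> \<theta>h) \<theta>h *v d)) (at \<theta>h)"
      (is "?Q \<Longrightarrow> ?Q'")
    and transpose_hamiltonian_control_hessian:
    "transpose (hessian (\<lambda>v. h (\<xi> \<theta>h) v \<theta>h) (\<upsilon> \<theta>h)) = hessian (\<lambda>v. h (\<xi> \<theta>h) v \<theta>h) (\<upsilon> \<theta>h)"
      (is ?R)
proof -
  obtain D E F where
    D: "\<And>q y v \<theta>. \<theta> \<in> S \<Longrightarrow>
      ((\<lambda>(y, v, \<theta>). hamiltonian f c k y v q \<theta>) has_derivative D q (y, v, \<theta>)) (at (y, v, \<theta>))"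
    and E: "\<And>q e y v \<theta>. \<theta> \<in> S \<Longrightarrow>
      ((\<lambda>z. D q z e) has_derivative (\<lambda>d. E q (y, v, \<theta>) d e)) (at (y, v, \<theta>))"
    and F: "\<And>w. ((\<lambda>(y, v). f y v) has_derivative F w) (at w)"
    and F_diff: "\<And>e w. (\<lambda>w. F w e) differentiable (at w)"
    and D_diff: "\<And>q q' y v \<theta> a b d.
      D q (y, v, \<theta>) (a, b, d) = D q' (y, v, \<theta>) (a, b, d) + F (y, v) (a, b) \<bullet> (q - q')"
    using hamiltonian_second_order[of f c k S, OF f c] by blast
  define y0 v0 q0 where "y0 = \<xi> \<theta>h" and "v0 = \<upsilon> \<theta>h" and "q0 = q \<theta>h"
  define D0 where "D0 = D q0"
  define E0 where "E0 = E q0 (y0, v0, \<theta>h)"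
  note D0 = D[where q = q0, folded D0_def]
  have E0: "((\<lambda>z. D0 z e) has_derivative (\<lambda>d. E0 d e)) (at (y0, v0, \<theta>h))" for e
    unfolding D0_def E0_def by (rule E[OF S(2)])
  have lin: "linear (\<lambda>d. E0 d e)" for e
    using E0 by (rule has_derivative_linear)
  \<comment> \<open>In \<open>E0 d e\<close> the vector \<open>d\<close> is the direction of the
    outer differentiation. Hessian entries carry their row index there, whereas the components
    computed in \<open>rows\<close> carry it in \<open>e\<close>; symmetry exchanges the
    two.\<close>
  have sym: "E0 a b = E0 b a" for a b
    by (rule second_derivative_symmetric[of "UNIV \<times> UNIV \<times> S" "(y0, v0, \<theta>h)" _ D0])
      (use S D0 E0 in \<open>auto intro!: open_Times\<close>)
  have dy: "((\<lambda>y. hamiltonian f c k y v q \<theta>) has_derivative (\<lambda>a. D q (y, v, \<theta>) (a, 0, 0))) (at y)"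
    and dv: "((\<lambda>v. hamiltonian f c k y v q \<theta>) has_derivative (\<lambda>b. D q (y, v, \<theta>) (0, b, 0))) (at v)"
    and dt: "((\<lambda>\<theta>. hamiltonian f c k y v q \<theta>) has_derivative (\<lambda>d. D q (y, v, \<theta>) (0, 0, d))) (at \<theta>)"
    if "\<theta> \<in> S" for q y v \<theta>
  proof -
    have "((\<lambda>y. (y, v, \<theta>)) has_derivative (\<lambda>a. (a, 0, 0))) (at y)"
      "((\<lambda>v. (y, v, \<theta>)) has_derivative (\<lambda>b. (0, b, 0))) (at v)"
      "((\<lambda>\<theta>. (y, v, \<theta>)) has_derivative (\<lambda>d. (0, 0, d))) (at \<theta>)"
      by (auto intro!: derivative_eq_intros simp: zero_prod_def)
    from this[THEN has_derivative_compose, OF D[OF that]]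
    show "((\<lambda>y. hamiltonian f c k y v q \<theta>) has_derivative (\<lambda>a. D q (y, v, \<theta>) (a, 0, 0))) (at y)"
      "((\<lambda>v. hamiltonian f c k y v q \<theta>) has_derivative (\<lambda>b. D q (y, v, \<theta>) (0, b, 0))) (at v)"
      "((\<lambda>\<theta>. hamiltonian f c k y v q \<theta>) has_derivative (\<lambda>d. D q (y, v, \<theta>) (0, 0, d))) (at \<theta>)"
      by simp_all
  qed
  have ey: "((\<lambda>y. D0 (y, v0, \<theta>h) e) has_derivative (\<lambda>a. E0 (a, 0, 0) e)) (at y0)"
    and ev: "((\<lambda>v. D0 (y0, v, \<theta>h) e) has_derivative (\<lambda>b. E0 (0, b, 0) e)) (at v0)" for e
  proof -
    have "((\<lambda>y. (y, v0, \<theta>h)) has_derivative (\<lambda>a. (a, 0, 0))) (at y0)"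
      "((\<lambda>v. (y0, v, \<theta>h)) has_derivative (\<lambda>b. (0, b, 0))) (at v0)"
      by (auto intro!: derivative_eq_intros simp: zero_prod_def)
    from this[THEN has_derivative_compose, OF E0]
    show "((\<lambda>y. D0 (y, v0, \<theta>h) e) has_derivative (\<lambda>a. E0 (a, 0, 0) e)) (at y0)"
      "((\<lambda>v. D0 (y0, v, \<theta>h) e) has_derivative (\<lambda>b. E0 (0, b, 0) e)) (at v0)"
      by simp_all
  qed
  note d0 = dy[OF S(2), where q = q0, folded D0_def] dv[OF S(2), where q = q0, folded D0_def]
    dt[OF S(2), where q = q0, folded D0_def]
  have h: "h y v \<theta> = hamiltonian f c k y v q0 \<theta>" for y v \<theta>
    by (simp add: h_def q0_def)
  define Hxx Hxu Hxe Huu Hue where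
    "Hxx = hessian (\<lambda>y. h y v0 \<theta>h) y0" and "Hxu = mixed_hessian (\<lambda>y v. h y v \<theta>h) y0 v0"
    and "Hxe = mixed_hessian (\<lambda>y \<theta>. h y v0 \<theta>) y0 \<theta>h"
    and "Huu = hessian (\<lambda>v. h y0 v \<theta>h) v0" and "Hue = mixed_hessian (\<lambda>v \<theta>. h y0 v \<theta>) v0 \<theta>h"
  have Hxx: "Hxx $ i $ j = E0 (axis i 1, 0, 0) (axis j 1, 0, 0)" for i j
    unfolding Hxx_def h by (rule hessian_nth[OF d0(1) ey])
  have Hxu: "Hxu $ i $ j = E0 (axis i 1, 0, 0) (0, axis j 1, 0)" for i j
    unfolding Hxu_def h by (rule mixed_hessian_nth[OF d0(2) ey])
  have Hxe: "Hxe $ i $ j = E0 (axis i 1, 0, 0) (0, 0, axis j 1)" for i j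
    unfolding Hxe_def h by (rule mixed_hessian_nth[OF d0(3) ey])
  have Huu: "Huu $ i $ j = E0 (0, axis i 1, 0) (0, axis j 1, 0)" for i j
    unfolding Huu_def h by (rule hessian_nth[OF d0(2) ev])
  have Hue: "Hue $ i $ j = E0 (0, axis i 1, 0) (0, 0, axis j 1)" for i j
    unfolding Hue_def h by (rule mixed_hessian_nth[OF d0(3) ev])
  have E0_split: "E0 (a, b, d) e = E0 (a, 0, 0) e + E0 (0, b, 0) e + E0 (0, 0, d) e" for a b d e
    using linear_add[OF lin[of e], of "(a, 0, 0) + (0, b, 0)" "(0, 0, d)"]
      linear_add[OF lin[of e], of "(a, 0, 0)" "(0, b, 0)"] by simp
  have lins: "linear (\<lambda>a. E0 (a, 0, 0) e)" "linear (\<lambda>b. E0 (0, b, 0) e)" "linear (\<lambda>d. E0 (0, 0, d) e)" for e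
  proof -
    have "linear (\<lambda>a. (a, 0, 0))" "linear (\<lambda>b. (0, b, 0))" "linear (\<lambda>d. (0, 0, d))"
      by (auto intro!: linearI)
    from this[THEN linear_compose, OF lin[of e]]
    show "linear (\<lambda>a. E0 (a, 0, 0) e)" "linear (\<lambda>b. E0 (0, b, 0) e)" "linear (\<lambda>d. E0 (0, 0, d) e)"
      by (simp_all add: o_def)
  qed
  have rows: "E0 (a, b, d) (axis i 1, 0, 0) = (Hxx *v a) $ i + (Hxu *v b) $ i + (Hxe *v d) $ i"
    "E0 (a, b, d) (0, axis j 1, 0) = (transpose Hxu *v a) $ j + (Huu *v b) $ j + (Hue *v d) $ j"
    for a b d i j
    unfolding E0_split[of a b d]
    by (intro arg_cong2[where f = "(+)"] linear_vec_expand lins;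
        simp add: Hxx Hxu Hxe Huu Hue transpose_def sym)+
  define Z where "Z \<theta> = (\<xi> \<theta>, \<upsilon> \<theta>, \<theta>)" for \<theta>
  have Z: "(Z has_derivative (\<lambda>d. (X d, U d, d))) (at \<theta>h)"
    unfolding Z_def[abs_def] using \<xi> \<upsilon> by (auto intro!: derivative_eq_intros simp: zero_prod_def)
  have key: "((\<lambda>\<theta>. D (q \<theta>) (Z \<theta>) (a, b, 0)) has_derivative
      (\<lambda>d. E0 (X d, U d, d) (a, b, 0) + F (y0, v0) (a, b) \<bullet> L d)) (at \<theta>h)" for a b
  proof -
    have D0Z: "((\<lambda>\<theta>. D0 (Z \<theta>) (a, b, 0)) has_derivative (\<lambda>d. E0 (X d, U d, d) (a, b, 0))) (at \<theta>h)"
      by (rule has_derivative_compose[OF Z]) (use E0 in \<open>simp add: Z_def y0_def v0_def\<close>)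
    \<comment> \<open>In the product rule the term with \<open>F'\<close> has the factor
      \<open>q \<theta>h - q0 = 0\<close>, so only \<open>F (y0, v0) (a, b) \<bullet> L d\<close> is
      left of the costate part.\<close>
    obtain F' where F': "((\<lambda>w. F w (a, b)) has_derivative F') (at (\<xi> \<theta>h, \<upsilon> \<theta>h))"
      using F_diff by (meson differentiable_def)
    have "((\<lambda>\<theta>. (\<xi> \<theta>, \<upsilon> \<theta>)) has_derivative (\<lambda>d. (X d, U d))) (at \<theta>h)"
      using \<xi> \<upsilon> by (rule has_derivative_Pair)
    from has_derivative_compose[OF this F']
    have FZ: "((\<lambda>\<theta>. F (\<xi> \<theta>, \<upsilon> \<theta>) (a, b)) has_derivative (\<lambda>d. F' (X d, U d))) (at \<theta>h)" .
    have "((\<lambda>\<theta>. q \<theta> - q0) has_derivative L) (at \<theta>h)"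
      using q by (auto intro!: derivative_eq_intros simp: zero_prod_def)
    note has_derivative_add[OF D0Z has_derivative_inner[OF FZ this]]
    moreover have "D (q \<theta>) (Z \<theta>) (a, b, 0) = D0 (Z \<theta>) (a, b, 0) + F (\<xi> \<theta>, \<upsilon> \<theta>) (a, b) \<bullet> (q \<theta> - q0)" for \<theta>
      unfolding Z_def D0_def by (rule D_diff)
    ultimately show ?thesis
      by (simp add: q0_def y0_def v0_def)
  qed
  have Jy: "F (y0, v0) (axis i 1, 0) \<bullet> w = (transpose (jacobian (\<lambda>y. f y v0) (at y0)) *v w) $ i"
    and Jv: "F (y0, v0) (0, axis j 1) \<bullet> w = (transpose (jacobian (\<lambda>v. f y0 v) (at v0)) *v w) $ j"
    for i j w
  proof -
    have "((\<lambda>y. (y, v0)) has_derivative (\<lambda>a. (a, 0))) (at y0)"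
      "((\<lambda>v. (y0, v)) has_derivative (\<lambda>b. (0, b))) (at v0)"
      by (auto intro!: derivative_eq_intros simp: zero_prod_def)
    from this[THEN has_derivative_compose, OF F]
    have "((\<lambda>y. f y v0) has_derivative (\<lambda>a. F (y0, v0) (a, 0))) (at y0)"
      "((\<lambda>v. f y0 v) has_derivative (\<lambda>b. F (y0, v0) (0, b))) (at v0)"
      by simp_all
    note this[THEN jacobian_vec, symmetric]
    then show "F (y0, v0) (axis i 1, 0) \<bullet> w = (transpose (jacobian (\<lambda>y. f y v0) (at y0)) *v w) $ i"
      "F (y0, v0) (0, axis j 1) \<bullet> w = (transpose (jacobian (\<lambda>v. f y0 v) (at v0)) *v w) $ j"
      by (simp_all add: inner_commute[of _ w] inner_matrix_vector_transpose inner_axis)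
  qed
  have near: "\<forall>\<^sub>F \<theta> in nhds \<theta>h. \<theta> \<in> S" using S by (rule eventually_nhds_in_open)
  show ?P' if ?P
  proof (rule has_derivative_vecI)
    fix i
    have ev: "\<forall>\<^sub>F \<theta> in nhds \<theta>h. D (q \<theta>) (Z \<theta>) (axis i 1, 0, 0) = r \<theta> $ i"
      using that near
    proof eventually_elim
      case (elim \<theta>)
      have "(\<lambda>e. r \<theta> \<bullet> e) = (\<lambda>a. D (q \<theta>) (\<xi> \<theta>, \<upsilon> \<theta>, \<theta>) (a, 0, 0))"
        by (rule has_derivative_unique[OF elim(1) dy[OF elim(2)]])
      from fun_cong[OF this, of "axis i 1"] show ?case
        by (simp add: inner_axis Z_def)
    qed
    have "((\<lambda>\<theta>. r \<theta> $ i) has_derivative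
        (\<lambda>d. E0 (X d, U d, d) (axis i 1, 0, 0) + F (y0, v0) (axis i 1, 0) \<bullet> L d)) (at \<theta>h)"
      by (rule has_derivative_transform_nhds[OF key ev])
    then show "((\<lambda>\<theta>. r \<theta> $ i) has_derivative (\<lambda>d. (hessian (\<lambda>y. h y (\<upsilon> \<theta>h) \<theta>h) (\<xi> \<theta>h) *v X d
          + mixed_hessian (\<lambda>y v. h y v \<theta>h) (\<xi> \<theta>h) (\<upsilon> \<theta>h) *v U d
          + transpose (jacobian (\<lambda>y. f y (\<upsilon> \<theta>h)) (at (\<xi> \<theta>h))) *v L d
          + mixed_hessian (\<lambda>y \<theta>. h y (\<upsilon> \<theta>h) \<theta>) (\<xi> \<theta>h) \<theta>h *v d) $ i)) (at \<theta>h)"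
      unfolding rows Jy unfolding Hxx_def Hxu_def Hxe_def y0_def v0_def
      by (simp add: add_ac)
  qed
  show ?Q' if ?Q
  proof (rule has_derivative_vecI)
    fix i
    have ev: "\<forall>\<^sub>F \<theta> in nhds \<theta>h. D (q \<theta>) (Z \<theta>) (0, axis i 1, 0) = s \<theta> $ i"
      using that near
    proof eventually_elim
      case (elim \<theta>)
      have "(\<lambda>e. s \<theta> \<bullet> e) = (\<lambda>b. D (q \<theta>) (\<xi> \<theta>, \<upsilon> \<theta>, \<theta>) (0, b, 0))"
        by (rule has_derivative_unique[OF elim(1) dv[OF elim(2)]])
      from fun_cong[OF this, of "axis i 1"] show ?case
        by (simp add: inner_axis Z_def)
    qed
    have "((\<lambda>\<theta>. s \<theta> $ i) has_derivative
        (\<lambda>d. E0 (X d, U d, d) (0, axis i 1, 0) + F (y0, v0) (0, axis i 1) \<bullet> L d)) (at \<theta>h)"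
      by (rule has_derivative_transform_nhds[OF key ev])
    then show "((\<lambda>\<theta>. s \<theta> $ i) has_derivative (\<lambda>d. (transpose (mixed_hessian (\<lambda>y v. h y v \<theta>h) (\<xi> \<theta>h) (\<upsilon> \<theta>h)) *v X d
          + hessian (\<lambda>v. h (\<xi> \<theta>h) v \<theta>h) (\<upsilon> \<theta>h) *v U d
          + transpose (jacobian (\<lambda>v. f (\<xi> \<theta>h) v) (at (\<upsilon> \<theta>h))) *v L d
          + mixed_hessian (\<lambda>v \<theta>. h (\<xi> \<theta>h) v \<theta>) (\<upsilon> \<theta>h) \<theta>h *v d) $ i)) (at \<theta>h)"
      unfolding rows Jv unfolding Hxu_def Huu_def Hue_def y0_def v0_def
      by (simp add: add_ac)
  qed
  have "transpose Huu = Huu"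
    by (simp add: vec_eq_iff transpose_def Huu sym)
  then show ?R unfolding Huu_def y0_def v0_def .
qed

section \<open>The terminal cost as a degenerate Hamiltonian\<close>

lemma twice_continuously_differentiable_on_compose_linear:
  fixes g :: "'a::real_normed_vector \<Rightarrow> 'b::real_normed_vector" and l :: "'c::real_normed_vector \<Rightarrow> 'a"
  assumes g: "twice_continuously_differentiable_on g S" and l: "bounded_linear l"
  shows "twice_continuously_differentiable_on (\<lambda>w. g (l w)) (l -` S)"
proof -
  obtain g' g'' where g': "\<forall>z\<in>S. (g has_derivative blinfun_apply (g' z)) (at z)"
    and g'': "\<forall>z\<in>S. (g' has_derivative blinfun_apply (g'' z)) (at z)"
    and cont: "continuous_on S g''"
    using g unfolding twice_continuously_differentiable_on_def by blast
  define L where "L = Blinfun l"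
  have L: "blinfun_apply L = l" unfolding L_def by (rule bounded_linear_Blinfun_apply[OF l])
  \<comment> \<open>Precomposition with \<open>l\<close>, as a bounded linear map on first
    derivatives. The chain rule applied to \<open>g' (l w) o\<^sub>L L\<close> then produces
    \<open>C o\<^sub>L g'' (l w) o\<^sub>L L\<close>.\<close>
  define C :: "('a \<Rightarrow>\<^sub>L 'b) \<Rightarrow>\<^sub>L ('c \<Rightarrow>\<^sub>L 'b)" where "C = Blinfun (\<lambda>\<phi>. \<phi> o\<^sub>L L)"
  have C_lin: "bounded_linear (\<lambda>\<phi> :: 'a \<Rightarrow>\<^sub>L 'b. \<phi> o\<^sub>L L)"
    by (rule bounded_bilinear.bounded_linear_left[OF bounded_bilinear_blinfun_compose])
  have C: "blinfun_apply C \<phi> = \<phi> o\<^sub>L L" for \<phi>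
    unfolding C_def by (simp add: bounded_linear_Blinfun_apply[OF C_lin])
  have dl: "(l has_derivative l) (at w)" for w
    by (rule bounded_linear_imp_has_derivative[OF l])
  show ?thesis
    unfolding twice_continuously_differentiable_on_def
  proof (intro exI conjI ballI)
    fix w assume "w \<in> l -` S"
    then have w: "l w \<in> S" by simp
    show "((\<lambda>w. g (l w)) has_derivative blinfun_apply (g' (l w) o\<^sub>L L)) (at w)"
      using has_derivative_compose[OF dl bspec[OF g' w]] by (simp add: blinfun_compose.rep_eq L o_def)
    show "((\<lambda>w. g' (l w) o\<^sub>L L) has_derivative blinfun_apply (C o\<^sub>L g'' (l w) o\<^sub>L L)) (at w)"
      using bounded_linear.has_derivative[OF C_lin has_derivative_compose[OF dl bspec[OF g'' w]]]
      by (simp add: blinfun_compose.rep_eq C L o_def)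
  next
    show "continuous_on (l -` S) (\<lambda>w. C o\<^sub>L g'' (l w) o\<^sub>L L)"
      by (intro bounded_bilinear.continuous_on[OF bounded_bilinear_blinfun_compose]
          continuous_on_const continuous_on_compose2[OF cont linear_continuous_on[OF l]]) auto
  qed
qed

lemma twice_continuously_differentiable_on_const:
  "twice_continuously_differentiable_on (\<lambda>w. b) S"
  unfolding twice_continuously_differentiable_on_def
  by (rule exI[of _ "\<lambda>_. 0"], rule exI[of _ "\<lambda>_. 0"]) (simp add: zero_blinfun.rep_eq)

text \<open>A terminal cost is a Hamiltonian with vanishing dynamics that ignores its control.\<close>
lemma terminal_gradient_derivative:
  fixes cT :: "real^'n \<Rightarrow> real^'p \<Rightarrow> real"
  assumes cT: "twice_continuously_differentiable_on (\<lambda>(y, \<theta>). cT y \<theta>) (UNIV \<times> S)"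
    and S: "open S" "\<theta>h \<in> S"
    and \<xi>: "(\<xi> has_derivative X) (at \<theta>h)"
    and r: "\<forall>\<^sub>F \<theta> in nhds \<theta>h. ((\<lambda>y. cT y \<theta>) has_derivative (\<lambda>e. r \<theta> \<bullet> e)) (at (\<xi> \<theta>))"
  shows "(r has_derivative (\<lambda>d. hessian (\<lambda>y. cT y \<theta>h) (\<xi> \<theta>h) *v X d
      + mixed_hessian cT (\<xi> \<theta>h) \<theta>h *v d)) (at \<theta>h)"
proof -
  \<comment> \<open>The dummy control borrows the state space as its type. Control and costate
    curves are taken constantly 0, so their derivatives vanish and only the terms in
    \<open>X d\<close> and \<open>d\<close> survive.\<close>
  let ?f = "\<lambda>(y :: real^'n) (v :: real^'n). 0 :: real^'n"
  let ?c = "\<lambda>(k :: nat) y (v :: real^'n) \<theta>. cT y \<theta>"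
  let ?l = "\<lambda>w :: (real^'n) \<times> (real^'n) \<times> (real^'p). (fst w, snd (snd w))"
  have "bounded_linear ?l"
    by (intro bounded_linear_Pair bounded_linear_fst bounded_linear_snd_comp bounded_linear_snd)
  from twice_continuously_differentiable_on_compose_linear[OF cT this]
  have "twice_continuously_differentiable_on (\<lambda>w. case ?l w of (y, \<theta>) \<Rightarrow> cT y \<theta>) (?l -` (UNIV \<times> S))" .
  moreover have "?l -` (UNIV \<times> S) = UNIV \<times> UNIV \<times> S" by auto
  ultimately have c: "twice_continuously_differentiable_on (\<lambda>(y, v, \<theta>). ?c 0 y v \<theta>) (UNIV \<times> UNIV \<times> S)"
    by (simp add: case_prod_beta')
  have f: "twice_continuously_differentiable_on (\<lambda>(y, v). ?f y v) UNIV"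
    by (simp add: case_prod_beta' twice_continuously_differentiable_on_const)
  show ?thesis
    using hamiltonian_state_gradient_derivative[where f = ?f and c = ?c and k = 0, OF f c S \<xi> has_derivative_const[of "0 :: real^'n"]
        has_derivative_const[of "0 :: real^'n"], of r] r
    by (simp add: hamiltonian_def)
qed

section \<open>Linear algebra of one Riccati step\<close>

lemma matrix_inv_works:
  assumes "invertible M"
  shows "M ** matrix_inv M = mat 1" "matrix_inv M ** M = mat 1"
proof -
  have "M ** matrix_inv M = mat 1 \<and> matrix_inv M ** M = mat 1"
    using assms unfolding invertible_def matrix_inv_def by (rule someI_ex)
  then show "M ** matrix_inv M = mat 1" "matrix_inv M ** M = mat 1" by auto
qed

lemma transpose_matrix_inv:
  fixes M :: "real^'n^'n"
  assumes M: "invertible M" and sym: "transpose M = M"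
  shows "transpose (matrix_inv M) = matrix_inv M"
proof -
  have left: "transpose (matrix_inv M) ** M = mat 1"
    by (metis M sym matrix_inv_works(1) matrix_transpose_mul transpose_mat)
  have "transpose (matrix_inv M) = transpose (matrix_inv M) ** (M ** matrix_inv M)"
    by (simp add: matrix_inv_works(1)[OF M])
  also have "\<dots> = matrix_inv M"
    by (simp add: matrix_mul_assoc left)
  finally show ?thesis .
qed

text \<open>\<open>x\<close>, \<open>u\<close> and \<open>l\<close> stand for X_k, U_k and L_{k+1}
  applied to a direction \<open>d\<close>. Solving stationarity for \<open>u\<close> makes the next
  state \<open>\<A> *v x + \<M> *v d - \<R> *v l\<close>. As \<open>l\<close> is \<open>P\<close>
  times this state plus \<open>W *v d\<close>, it occurs on both sides, and solving for it is the
  origin of the inverse of \<open>mat 1 + P ** \<R>\<close>.\<close>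

lemma riccati_step:
  fixes A Hxx \<A> \<R> \<Q> P :: "real^'n^'n" and B Hxu :: "real^'m^'n" and Hux :: "real^'n^'m"
    and Huu :: "real^'m^'m" and Hxe \<M> \<N> W :: "real^'p^'n" and Hue :: "real^'p^'m"
  assumes Hux: "Hux = transpose Hxu" and Huu: "invertible Huu" "transpose Huu = Huu"
    and \<A>: "\<A> = A - B ** matrix_inv Huu ** Hux"
    and \<R>: "\<R> = B ** matrix_inv Huu ** transpose B"
    and \<M>: "\<M> = - (B ** matrix_inv Huu ** Hue)"
    and \<Q>: "\<Q> = Hxx - Hxu ** matrix_inv Huu ** Hux"
    and \<N>: "\<N> = Hxe - Hxu ** matrix_inv Huu ** Hue"
    and inv: "invertible (mat 1 + P ** \<R>)"
    and l: "l = P *v (A *v x + B *v u) + W *v d"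
    and stationary: "Hux *v x + Huu *v u + transpose B *v l + Hue *v d = 0"
  shows riccati_control: "u = - (matrix_inv Huu *v (Hux *v x + Hue *v d + transpose B *v l))"
    and riccati_next_costate: "l = matrix_inv (mat 1 + P ** \<R>) *v (P *v (\<A> *v x) + P *v (\<M> *v d) + W *v d)"
    and riccati_costate: "Hxx *v x + Hxu *v u + transpose A *v l + Hxe *v d
      = (\<Q> + transpose \<A> ** matrix_inv (mat 1 + P ** \<R>) ** P ** \<A>) *v x
        + (transpose \<A> ** matrix_inv (mat 1 + P ** \<R>) ** (W + P ** \<M>) + \<N>) *v d"
proof -
  define V where "V = matrix_inv Huu"
  define G where "G = matrix_inv (mat 1 + P ** \<R>)"
  have neg: "(- M) *v y = - (M *v y)" for M :: "real^'a^'b" and y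
    using matrix_vector_mult_diff_rdistrib[of 0 M y] by simp
  have neg': "M *v (- y) = - (M *v y)" for M :: "real^'a^'b" and y
    using matrix_vector_mult_diff_distrib[of M 0 y] by simp
  have VT: "transpose V = V" unfolding V_def by (rule transpose_matrix_inv[OF Huu])
  have "Huu *v u = - (Hux *v x + Hue *v d + transpose B *v l)"
    using stationary by (simp only: eq_neg_iff_add_eq_0 ac_simps)
  then have "V *v (Huu *v u) = - (V *v (Hux *v x + Hue *v d + transpose B *v l))"
    by (simp only: neg')
  then show u: "u = - (matrix_inv Huu *v (Hux *v x + Hue *v d + transpose B *v l))"
    by (simp add: V_def matrix_vector_mul_assoc matrix_inv_works(2)[OF Huu(1)])
  note u = u[folded V_def]
  note mv = matrix_vector_mul_assoc[symmetric] matrix_vector_mult_add_rdistrib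
    matrix_vector_mult_diff_rdistrib matrix_vector_right_distrib matrix_vector_mult_diff_distrib neg neg'
  have x': "A *v x + B *v u = \<A> *v x + \<M> *v d - \<R> *v l"
    unfolding u \<A> \<M> \<R> V_def[symmetric] by (simp add: mv del: transpose_matrix_vector)
  have "(mat 1 + P ** \<R>) *v l = P *v (\<A> *v x) + P *v (\<M> *v d) + W *v d"
    using l unfolding x' by (simp add: mv algebra_simps del: transpose_matrix_vector)
  then have "G *v ((mat 1 + P ** \<R>) *v l) = G *v (P *v (\<A> *v x) + P *v (\<M> *v d) + W *v d)"
    by simp
  then show l': "l = matrix_inv (mat 1 + P ** \<R>) *v (P *v (\<A> *v x) + P *v (\<M> *v d) + W *v d)"
    unfolding matrix_vector_mul_assoc[of G] unfolding G_def
    by (simp add: matrix_inv_works(2)[OF inv])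
  have transpose_diff: "transpose (M - N) = transpose M - transpose N" for M N :: "real^'n^'n"
    by (simp add: transpose_def vec_eq_iff)
  \<comment> \<open>Eliminating \<open>u\<close> from the costate equation leaves \<open>l\<close>
    with the coefficient on the right; symmetry of \<open>V\<close> identifies it with
    \<open>transpose \<A>\<close>.\<close>
  have \<A>T: "transpose \<A> = transpose A - Hxu ** V ** transpose B"
    unfolding \<A> V_def[symmetric] transpose_diff matrix_transpose_mul VT
    by (simp add: Hux matrix_mul_assoc)
  have "Hxx *v x + Hxu *v u + transpose A *v l + Hxe *v d = \<Q> *v x + transpose \<A> *v l + \<N> *v d"
    unfolding \<A>T u \<Q> \<N> V_def[symmetric] by (simp add: mv del: transpose_matrix_vector)
  then show "Hxx *v x + Hxu *v u + transpose A *v l + Hxe *v d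
      = (\<Q> + transpose \<A> ** matrix_inv (mat 1 + P ** \<R>) ** P ** \<A>) *v x
        + (transpose \<A> ** matrix_inv (mat 1 + P ** \<R>) ** (W + P ** \<M>) + \<N>) *v d"
    by (subst (asm) l') (simp add: mv del: transpose_matrix_vector)
qed

section \<open>Sensitivities along the optimal trajectory\<close>

lemma differentiable_partials:
  assumes "twice_continuously_differentiable_on (\<lambda>(y, v). g y v) S" and "(y, v) \<in> S"
  shows "(\<lambda>y. g y v) differentiable (at y)" and "(\<lambda>v. g y v) differentiable (at v)"
proof -
  obtain D where D: "((\<lambda>(y, v). g y v) has_derivative D) (at (y, v))"
    using assms unfolding twice_continuously_differentiable_on_def by blast
  have "((\<lambda>y. (y, v)) has_derivative (\<lambda>a. (a, 0))) (at y)" "((\<lambda>v. (y, v)) has_derivative (\<lambda>b. (0, b))) (at v)"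
    by (auto intro!: derivative_eq_intros)
  from this[THEN has_derivative_compose, OF D]
  show "(\<lambda>y. g y v) differentiable (at y)" "(\<lambda>v. g y v) differentiable (at v)"
    by (auto simp: differentiable_def)
qed

theorem mainTheorem2:
  fixes T :: nat
    and x0 :: "real^'n"
    and f :: "real^'n \<Rightarrow> real^'m \<Rightarrow> real^'n"
    and c :: "nat \<Rightarrow> real^'n \<Rightarrow> real^'m \<Rightarrow> real^'p \<Rightarrow> real"
    and cT :: "real^'n \<Rightarrow> real^'p \<Rightarrow> real"
    and \<Theta> :: "(real^'p) set"
    and \<theta>h :: "real^'p"
    and x p :: "nat \<Rightarrow> real^'p \<Rightarrow> real^'n"
    and u :: "nat \<Rightarrow> real^'p \<Rightarrow> real^'m"
    and A Hxx \<A> \<R> \<Q> \<P> :: "nat \<Rightarrow> real^'n^'n"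
    and B Hxu :: "nat \<Rightarrow> real^'m^'n"
    and Hux :: "nat \<Rightarrow> real^'n^'m"
    and Huu :: "nat \<Rightarrow> real^'m^'m"
    and Hxe \<M> \<N> \<W> :: "nat \<Rightarrow> real^'p^'n"
    and Hue :: "nat \<Rightarrow> real^'p^'m"
  assumes T_pos: "0 < T"
    and f_C2: "twice_continuously_differentiable_on (\<lambda>(y, v). f y v) UNIV"
    and c_C2: "\<And>t. t < T \<Longrightarrow>
      twice_continuously_differentiable_on (\<lambda>(y, v, \<theta>). c t y v \<theta>) (UNIV \<times> UNIV \<times> interior \<Theta>)"
    and cT_C2: "twice_continuously_differentiable_on (\<lambda>(y, \<theta>). cT y \<theta>) (UNIV \<times> interior \<Theta>)"
    and \<theta>h: "\<theta>h \<in> interior \<Theta>"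
    and optimal: "\<forall>\<^sub>F \<theta> in nhds \<theta>h. is_optimal T x0 f c cT \<theta> (\<lambda>k. x k \<theta>) (\<lambda>k. u k \<theta>)"
    and x_diff: "\<And>k. k \<le> T \<Longrightarrow> x k differentiable (at \<theta>h)"
    and u_diff: "\<And>k. k < T \<Longrightarrow> u k differentiable (at \<theta>h)"
    and p_T: "\<And>\<theta>. \<theta> \<in> \<Theta> \<Longrightarrow> p T \<theta> = gradient (\<lambda>y. cT y \<theta>) (x T \<theta>)"
    and p_k: "\<And>\<theta> k. \<theta> \<in> \<Theta> \<Longrightarrow> 1 \<le> k \<Longrightarrow> k < T \<Longrightarrow>
      p k \<theta> = gradient (\<lambda>y. c k y (u k \<theta>) \<theta>) (x k \<theta>)
        + transpose (jacobian (\<lambda>y. f y (u k \<theta>)) (at (x k \<theta>))) *v p (Suc k) \<theta>"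
    and A: "\<And>k. k < T \<Longrightarrow> A k = jacobian (\<lambda>y. f y (u k \<theta>h)) (at (x k \<theta>h))"
    and B: "\<And>k. k < T \<Longrightarrow> B k = jacobian (\<lambda>v. f (x k \<theta>h) v) (at (u k \<theta>h))"
    and Hxx: "\<And>k. k < T \<Longrightarrow> Hxx k =
      hessian (\<lambda>y. hamiltonian f c k y (u k \<theta>h) (p (Suc k) \<theta>h) \<theta>h) (x k \<theta>h)"
    and Hxe: "\<And>k. k < T \<Longrightarrow> Hxe k =
      mixed_hessian (\<lambda>y \<theta>. hamiltonian f c k y (u k \<theta>h) (p (Suc k) \<theta>h) \<theta>) (x k \<theta>h) \<theta>h"
    and Hxu: "\<And>k. k < T \<Longrightarrow> Hxu k =
      mixed_hessian (\<lambda>y v. hamiltonian f c k y v (p (Suc k) \<theta>h) \<theta>h) (x k \<theta>h) (u k \<theta>h)"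
    and Hux: "\<And>k. k < T \<Longrightarrow> Hux k = transpose (Hxu k)"
    and Huu: "\<And>k. k < T \<Longrightarrow> Huu k =
      hessian (\<lambda>v. hamiltonian f c k (x k \<theta>h) v (p (Suc k) \<theta>h) \<theta>h) (u k \<theta>h)"
    and Hue: "\<And>k. k < T \<Longrightarrow> Hue k =
      mixed_hessian (\<lambda>v \<theta>. hamiltonian f c k (x k \<theta>h) v (p (Suc k) \<theta>h) \<theta>) (u k \<theta>h) \<theta>h"
    and HxxT: "Hxx T = hessian (\<lambda>y. cT y \<theta>h) (x T \<theta>h)"
    and HxeT: "Hxe T = mixed_hessian cT (x T \<theta>h) \<theta>h"
    and Huu_inv: "\<And>k. k < T \<Longrightarrow> invertible (Huu k)"
    and \<A>: "\<And>k. k < T \<Longrightarrow> \<A> k = A k - B k ** matrix_inv (Huu k) ** Hux k"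
    and \<R>: "\<And>k. k < T \<Longrightarrow> \<R> k = B k ** matrix_inv (Huu k) ** transpose (B k)"
    and \<M>: "\<And>k. k < T \<Longrightarrow> \<M> k = - (B k ** matrix_inv (Huu k) ** Hue k)"
    and \<Q>: "\<And>k. k < T \<Longrightarrow> \<Q> k = Hxx k - Hxu k ** matrix_inv (Huu k) ** Hux k"
    and \<N>: "\<And>k. k < T \<Longrightarrow> \<N> k = Hxe k - Hxu k ** matrix_inv (Huu k) ** Hue k"
    and \<P>_T: "\<P> T = Hxx T"
    and \<P>_k: "\<And>k. k < T \<Longrightarrow> \<P> k = \<Q> k
      + transpose (\<A> k) ** matrix_inv (mat 1 + \<P> (Suc k) ** \<R> k) ** \<P> (Suc k) ** \<A> k"
    and \<W>_T: "\<W> T = Hxe T"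
    and \<W>_k: "\<And>k. k < T \<Longrightarrow> \<W> k =
      transpose (\<A> k) ** matrix_inv (mat 1 + \<P> (Suc k) ** \<R> k)
        ** (\<W> (Suc k) + \<P> (Suc k) ** \<M> k) + \<N> k"
    and \<P>\<R>_inv: "\<And>k. k < T \<Longrightarrow> invertible (mat 1 + \<P> (Suc k) ** \<R> k)"
  shows "jacobian (x 0) (at \<theta>h) = 0 \<and>
    (\<forall>k<T.
      jacobian (u k) (at \<theta>h) =
        - (matrix_inv (Huu k) **
            (Hux k ** jacobian (x k) (at \<theta>h) + Hue k
              + transpose (B k) ** matrix_inv (mat 1 + \<P> (Suc k) ** \<R> k)
                ** (\<P> (Suc k) ** \<A> k ** jacobian (x k) (at \<theta>h)
                    + \<P> (Suc k) ** \<M> k + \<W> (Suc k)))) \<and>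
      jacobian (x (Suc k)) (at \<theta>h) =
        A k ** jacobian (x k) (at \<theta>h) + B k ** jacobian (u k) (at \<theta>h))"
proof -
  \<comment> \<open>The costs are smooth over the interior of \<Theta>, the costate equations hold
    on \<Theta>; both are available on the open set \<open>I\<close> around \<theta>h.\<close>
  define I where "I = interior \<Theta>"
  have I: "open I" "\<theta>h \<in> I" "I \<subseteq> \<Theta>"
    using \<theta>h by (auto simp: I_def interior_subset)
  note C2 = c_C2[folded I_def] cT_C2[folded I_def]
  have near: "\<forall>\<^sub>F \<theta> in nhds \<theta>h. \<theta> \<in> I" using I(1,2) by (rule eventually_nhds_in_open)
  have opt: "\<forall>\<^sub>F \<theta> in nhds \<theta>h. \<theta> \<in> I \<and> is_optimal T x0 f c cT \<theta> (\<lambda>k. x k \<theta>) (\<lambda>k. u k \<theta>)"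
    using near optimal by eventually_elim simp
  have fy: "(\<lambda>y. f y v) differentiable (at y)" and fv: "(\<lambda>v. f y v) differentiable (at v)" for y v
    using differentiable_partials(1)[OF f_C2, of y v] differentiable_partials(2)[OF f_C2, of y v] by auto
  have cy: "(\<lambda>y. c t y v \<theta>) differentiable (at y)"
    and cv: "(\<lambda>v. c t y v \<theta>) differentiable (at v)" if "t < T" "\<theta> \<in> I" for t y v \<theta>
  proof -
    have "twice_continuously_differentiable_on (\<lambda>(y, w). case w of (v, \<theta>) \<Rightarrow> c t y v \<theta>) (UNIV \<times> UNIV \<times> I)"
      using C2(1)[OF that(1)] by (simp add: case_prod_beta')
    note partials = differentiable_partials[OF this, of y "(v, \<theta>)"]
    show "(\<lambda>y. c t y v \<theta>) differentiable (at y)" using partials(1) that(2) by simp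
    have "(\<lambda>w. case w of (v, \<theta>) \<Rightarrow> c t y v \<theta>) differentiable (at (v, \<theta>))"
      using partials(2) that(2) by simp
    moreover have "(\<lambda>v. (v, \<theta>)) differentiable (at v)" by simp
    ultimately show "(\<lambda>v. c t y v \<theta>) differentiable (at v)"
      using differentiable_compose[of "\<lambda>w. case w of (v, \<theta>) \<Rightarrow> c t y v \<theta>" "\<lambda>v. (v, \<theta>)" v UNIV] by simp
  qed
  have cTy: "(\<lambda>y. cT y \<theta>) differentiable (at y)" if "\<theta> \<in> I" for y \<theta>
    using differentiable_partials(1)[OF C2(2), of y \<theta>] that by simp
  have traj: "x 0 \<theta> = x0" "\<And>k. k < T \<Longrightarrow> x (Suc k) \<theta> = f (x k \<theta>) (u k \<theta>)"
    if "is_optimal T x0 f c cT \<theta> (\<lambda>k. x k \<theta>) (\<lambda>k. u k \<theta>)" for \<theta>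
    using that by (auto simp: is_optimal_def is_trajectory_def)

  define X where "X k = jacobian (x k) (at \<theta>h)" for k
  define U where "U k = jacobian (u k) (at \<theta>h)" for k
  have X: "(x k has_derivative (*v) (X k)) (at \<theta>h)" if "k \<le> T" for k
    using x_diff[OF that] jacobian_works unfolding X_def by blast
  have U: "(u k has_derivative (*v) (U k)) (at \<theta>h)" if "k < T" for k
    using u_diff[OF that] jacobian_works unfolding U_def by blast

  have X_0: "X 0 = 0"
  proof -
    have "(x 0 has_derivative (\<lambda>d. 0)) (at \<theta>h)"
      by (rule has_derivative_transform_nhds[OF has_derivative_const[of x0]])
        (use optimal in \<open>auto simp: traj(1) elim: eventually_mono\<close>)
    from has_derivative_unique[OF X[of 0] this] show ?thesis
      by (simp add: matrix_eq fun_eq_iff)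
  qed

  have X_Suc: "X (Suc k) *v d = A k *v (X k *v d) + B k *v (U k *v d)" if k: "k < T" for k d
  proof -
    \<comment> \<open>\<open>A k\<close> and \<open>B k\<close> are the restrictions of the joint
      derivative \<open>F\<close> to the two factors, and
      \<open>F (a, b) = F (a, 0) + F (0, b)\<close>.\<close>
    obtain F where F: "((\<lambda>(y, v). f y v) has_derivative F) (at (x k \<theta>h, u k \<theta>h))"
      using f_C2 unfolding twice_continuously_differentiable_on_def by blast
    have "((\<lambda>y. (y, u k \<theta>h)) has_derivative (\<lambda>a. (a, 0))) (at (x k \<theta>h))"
      "((\<lambda>v. (x k \<theta>h, v)) has_derivative (\<lambda>b. (0, b))) (at (u k \<theta>h))"
      by (auto intro!: derivative_eq_intros)
    from this[THEN has_derivative_compose, OF F]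
    have "((\<lambda>y. f y (u k \<theta>h)) has_derivative (\<lambda>a. F (a, 0))) (at (x k \<theta>h))"
      "((\<lambda>v. f (x k \<theta>h) v) has_derivative (\<lambda>b. F (0, b))) (at (u k \<theta>h))"
      by simp_all
    from this[THEN jacobian_vec] have AB: "A k *v a = F (a, 0)" "B k *v b = F (0, b)" for a b
      by (simp_all add: A[OF k] B[OF k])
    have "((\<lambda>\<theta>. f (x k \<theta>) (u k \<theta>)) has_derivative (\<lambda>d. F (X k *v d, U k *v d))) (at \<theta>h)"
      using has_derivative_compose[OF has_derivative_Pair[OF X[of k] U[of k]] F] k by simp
    then have "(x (Suc k) has_derivative (\<lambda>d. F (X k *v d, U k *v d))) (at \<theta>h)"
      by (rule has_derivative_transform_nhds)
        (use optimal k in \<open>auto simp: traj(2) elim: eventually_mono\<close>)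
    from has_derivative_unique[OF X[of "Suc k"] this] k
    have "X (Suc k) *v d = F (X k *v d, U k *v d)" by (simp add: fun_eq_iff)
    also have "\<dots> = F (X k *v d, 0) + F (0, U k *v d)"
      using linear_add[OF has_derivative_linear[OF F], of "(X k *v d, 0)" "(0, U k *v d)"] by simp
    finally show ?thesis by (simp add: AB)
  qed

  \<comment> \<open>\<open>L\<close> is left open, since at this point no derivative of the costate
    is known. The control gradient is constantly 0 near \<theta>h, so the derivative computed for it
    must be 0 by uniqueness.\<close>
  have stationary: "Hux k *v (X k *v d) + Huu k *v (U k *v d) + transpose (B k) *v (L d) + Hue k *v d = 0"
    if k: "k < T" and L: "(p (Suc k) has_derivative L) (at \<theta>h)" for k L d
  proof -
    have "\<forall>\<^sub>F \<theta> in nhds \<theta>h.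
        ((\<lambda>v. hamiltonian f c k (x k \<theta>) v (p (Suc k) \<theta>) \<theta>) has_derivative (\<lambda>e. 0 \<bullet> e)) (at (u k \<theta>))"
      using opt
    proof eventually_elim
      case (elim \<theta>)
      then have "\<theta> \<in> \<Theta>" using I(3) by blast
      have "((\<lambda>v. hamiltonian f c k ((\<lambda>k. x k \<theta>) k) v ((\<lambda>k. p k \<theta>) (Suc k)) \<theta>) has_derivative (\<lambda>e. 0))
          (at ((\<lambda>k. u k \<theta>) k))"
        by (rule optimal_control_stationary[OF _ k])
          (use elim \<open>\<theta> \<in> \<Theta>\<close> fy fv cy cv cTy p_T p_k in auto)
      then show ?case by simp
    qed
    from hamiltonian_control_gradient_derivative[where f = f and c = c and k = k, OF f_C2 C2(1)[OF k] I(1,2) X[of k] U[OF k] L this] k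
    have "((\<lambda>\<theta>. 0) has_derivative (\<lambda>d. Hux k *v (X k *v d) + Huu k *v (U k *v d)
        + transpose (B k) *v (L d) + Hue k *v d)) (at \<theta>h)"
      by (simp only: Hux[OF k] Hxu[OF k] Huu[OF k] B[OF k] Hue[OF k])
    from has_derivative_unique[OF this has_derivative_const] show ?thesis
      by (simp add: fun_eq_iff)
  qed

  have sym: "transpose (Huu k) = Huu k" if k: "k < T" "(p (Suc k) has_derivative L) (at \<theta>h)" for k L
    using transpose_hamiltonian_control_hessian[where f = f and c = c and k = k, OF f_C2 C2(1)[OF k(1)] I(1,2) X[of k] U[OF k(1)] k(2)] k(1)
    by (simp add: Huu[OF k(1)])

  \<comment> \<open>This yields existence of the derivative and its value at once. Starting at
    \<open>k = 1\<close> suffices: the control at stage \<open>k\<close>, including 0, involves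
    \<open>p (Suc k)\<close>.\<close>
  have costate: "(p k has_derivative (\<lambda>d. \<P> k *v (X k *v d) + \<W> k *v d)) (at \<theta>h)"
    if "k + j = T" "1 \<le> k" for k j
    using that
  proof (induction j arbitrary: k)
    case 0
    have "\<forall>\<^sub>F \<theta> in nhds \<theta>h. ((\<lambda>y. cT y \<theta>) has_derivative (\<lambda>e. p T \<theta> \<bullet> e)) (at (x T \<theta>))"
      using near
    proof eventually_elim
      case (elim \<theta>)
      then obtain D where D: "((\<lambda>y. cT y \<theta>) has_derivative D) (at (x T \<theta>))"
        using cTy by (meson differentiable_def)
      moreover have "D = (\<lambda>e. p T \<theta> \<bullet> e)"
        using gradient_inner[OF D] p_T[of \<theta>] elim I(3) by (auto simp: fun_eq_iff)
      ultimately show ?case by simp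
    qed
    from terminal_gradient_derivative[OF C2(2) I(1,2) X[OF order_refl] this] 0
    show ?case by (simp add: \<P>_T \<W>_T HxxT HxeT)
  next
    case (Suc j)
    then have k: "k < T" by simp
    \<comment> \<open>The derivative of \<open>p (Suc k)\<close> from the induction hypothesis.
      Rewriting X_{k+1} by \<open>X_Suc\<close> gives it the shape that \<open>riccati_step\<close>
      requires of \<open>l\<close>.\<close>
    define L where "L d = \<P> (Suc k) *v (X (Suc k) *v d) + \<W> (Suc k) *v d" for d
    have L: "(p (Suc k) has_derivative L) (at \<theta>h)"
      unfolding L_def[abs_def] using Suc.IH[of "Suc k"] Suc.prems by simp
    have "\<forall>\<^sub>F \<theta> in nhds \<theta>h.
        ((\<lambda>y. hamiltonian f c k y (u k \<theta>) (p (Suc k) \<theta>) \<theta>) has_derivative (\<lambda>e. p k \<theta> \<bullet> e)) (at (x k \<theta>))"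
      using near
    proof eventually_elim
      case (elim \<theta>)
      then have "\<theta> \<in> \<Theta>" using I(3) by blast
      from p_k[OF this Suc.prems(2) k] show ?case
        using hamiltonian_state_gradient[of f "u k \<theta>" "x k \<theta>" c k \<theta> "p (Suc k) \<theta>", OF fy cy[OF k elim]]
        by simp
    qed
    from hamiltonian_state_gradient_derivative[where f = f and c = c and k = k, OF f_C2 C2(1)[OF k] I(1,2) X[of k] U[OF k] L this] k
    have "(p k has_derivative (\<lambda>d. Hxx k *v (X k *v d) + Hxu k *v (U k *v d)
        + transpose (A k) *v L d + Hxe k *v d)) (at \<theta>h)"
      by (simp only: Hxx[OF k] Hxu[OF k] A[OF k] Hxe[OF k])
    moreover have "Hxx k *v (X k *v d) + Hxu k *v (U k *v d) + transpose (A k) *v L d + Hxe k *v d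
        = \<P> k *v (X k *v d) + \<W> k *v d" for d
      unfolding \<P>_k[OF k] \<W>_k[OF k]
      by (rule riccati_costate[OF Hux[OF k] Huu_inv[OF k] sym[OF k L] \<A>[OF k] \<R>[OF k] \<M>[OF k]
            \<Q>[OF k] \<N>[OF k] \<P>\<R>_inv[OF k] _ stationary[OF k L]])
        (simp only: L_def X_Suc[OF k])
    ultimately show ?case by simp
  qed

  have "U k = - (matrix_inv (Huu k) **
            (Hux k ** X k + Hue k
              + transpose (B k) ** matrix_inv (mat 1 + \<P> (Suc k) ** \<R> k)
                ** (\<P> (Suc k) ** \<A> k ** X k + \<P> (Suc k) ** \<M> k + \<W> (Suc k))))" if k: "k < T" for k
    unfolding matrix_eq
  proof
    fix d
    define L where "L d = \<P> (Suc k) *v (X (Suc k) *v d) + \<W> (Suc k) *v d" for d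
    have L: "(p (Suc k) has_derivative L) (at \<theta>h)"
      unfolding L_def[abs_def] using costate[of "Suc k" "T - Suc k"] k by simp
    have Ld: "L d = \<P> (Suc k) *v (A k *v (X k *v d) + B k *v (U k *v d)) + \<W> (Suc k) *v d"
      by (simp only: L_def X_Suc[OF k])
    note step = Hux[OF k] Huu_inv[OF k] sym[OF k L] \<A>[OF k] \<R>[OF k] \<M>[OF k]
            \<Q>[OF k] \<N>[OF k] \<P>\<R>_inv[OF k] Ld stationary[OF k L]
    have neg: "(- M) *v y = - (M *v y)" for M :: "real^'p^'m" and y
      using matrix_vector_mult_diff_rdistrib[of 0 M y] by simp
    \<comment> \<open>\<open>riccati_control\<close> still contains the costate derivative;
      \<open>riccati_next_costate\<close> expresses that through X_k alone, which gives the feedback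
      form.\<close>
    show "U k *v d = - (matrix_inv (Huu k) **
            (Hux k ** X k + Hue k
              + transpose (B k) ** matrix_inv (mat 1 + \<P> (Suc k) ** \<R> k)
                ** (\<P> (Suc k) ** \<A> k ** X k + \<P> (Suc k) ** \<M> k + \<W> (Suc k)))) *v d"
      using riccati_control[OF step] riccati_next_costate[OF step]
      by (simp only: neg matrix_vector_mul_assoc[symmetric] matrix_vector_mult_add_rdistrib)
  qed
  moreover have "X (Suc k) = A k ** X k + B k ** U k" if "k < T" for k
    unfolding matrix_eq using X_Suc[OF that]
    by (simp add: matrix_vector_mult_add_rdistrib flip: matrix_vector_mul_assoc)
  ultimately show ?thesis
    using X_0 unfolding X_def U_def by blast
qed

end
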